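(* Assume Szpiro's conjecture and Néron's conjecture (as stated in the context). Let $V$ be a finite set of positive integers and $t\geq 1$ such that $D(V)$ is isomorphic to the complete bipartite graph $K_{t,t}$, and let $a,b\in V$ belong to the same vertex class of this bipartite graph. Then there exists a constant $C$ depending only on $\omega(ab(a-b))$ such that $t<C$.
   Context: For a finite set $V$ of positive integers, the Diophantine graph $D(V)$ has vertex set $V$, and two distinct elements $a,b\in V$ are linked by an edge if and only if $ab+1$ is a perfect square. For a nonzero integer $d$, $\omega(d)$ is the number of distinct prime factors of $d$. Szpiro's conjecture (over $\mathbb{Q}$): for every $\varepsilon>0$ there are only finitely many elliptic curves $E$ over $\mathbb{Q}$ with $\frac{\log|D_E|}{\log C_E}\geq 6+\varepsilon$, where $D_E$ is the minimal discriminant and $C_E$ the conductor of $E$. Néron's conjecture: the ranks of elliptic curves over $\mathbb{Q}$ are uniformly bounded. *)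

theory Defs
  imports
    Complex_Main
    "HOL-Library.FuncSet"
    "HOL-Library.Extended_Nat"
    "HOL-Computational_Algebra.Computational_Algebra"
    "HOL-Algebra.Algebraic_Closure_Type"
    "HOL-Algebra.Algebra"
    "Graph_Theory.Kuratowski"
begin

section \<open>Weierstrass equations\<close>

text \<open>The equation \<open>y\<^sup>2 + a\<^sub>1xy + a\<^sub>3y = x\<^sup>3 + a\<^sub>2x\<^sup>2 + a\<^sub>4x + a\<^sub>6\<close>.\<close>

datatype 'a weierstrass =
  Weierstrass (wa1: 'a) (wa2: 'a) (wa3: 'a) (wa4: 'a) (wa6: 'a)

definition wb2 :: "'a::comm_ring_1 weierstrass \<Rightarrow> 'a" where
  "wb2 W = wa1 W ^ 2 + 4 * wa2 W"

definition wb4 :: "'a::comm_ring_1 weierstrass \<Rightarrow> 'a" where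
  "wb4 W = 2 * wa4 W + wa1 W * wa3 W"

definition wb6 :: "'a::comm_ring_1 weierstrass \<Rightarrow> 'a" where
  "wb6 W = wa3 W ^ 2 + 4 * wa6 W"

definition wb8 :: "'a::comm_ring_1 weierstrass \<Rightarrow> 'a" where
  "wb8 W = wa1 W ^ 2 * wa6 W + 4 * wa2 W * wa6 W - wa1 W * wa3 W * wa4 W
     + wa2 W * wa3 W ^ 2 - wa4 W ^ 2"

definition wc4 :: "'a::comm_ring_1 weierstrass \<Rightarrow> 'a" where
  "wc4 W = wb2 W ^ 2 - 24 * wb4 W"

definition discriminant :: "'a::comm_ring_1 weierstrass \<Rightarrow> 'a" where
  "discriminant W =
     - (wb2 W ^ 2 * wb8 W) - 8 * wb4 W ^ 3 - 27 * wb6 W ^ 2 + 9 * wb2 W * wb4 W * wb6 W"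

definition elliptic :: "'a::field weierstrass \<Rightarrow> bool" where
  "elliptic E \<longleftrightarrow> discriminant E \<noteq> 0"

text \<open>Isomorphism over the field \<open>'a\<close>: the substitution
  \<open>x = u\<^sup>2x' + r\<close>, \<open>y = u\<^sup>3y' + su\<^sup>2x' + t\<close> turns the equation \<open>E\<close> into \<open>E'\<close>.\<close>

definition weierstrass_iso :: "'a::field weierstrass \<Rightarrow> 'a weierstrass \<Rightarrow> bool" where
  "weierstrass_iso E E' \<longleftrightarrow> (\<exists>u r s t. u \<noteq> 0 \<and>
     u * wa1 E' = wa1 E + 2 * s \<and>
     u ^ 2 * wa2 E' = wa2 E - s * wa1 E + 3 * r - s ^ 2 \<and>
     u ^ 3 * wa3 E' = wa3 E + r * wa1 E + 2 * t \<and>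
     u ^ 4 * wa4 E' = wa4 E - s * wa3 E + 2 * r * wa2 E - (t + r * s) * wa1 E
       + 3 * r ^ 2 - 2 * s * t \<and>
     u ^ 6 * wa6 E' = wa6 E + r * wa4 E + r ^ 2 * wa2 E + r ^ 3 - t * wa3 E
       - t ^ 2 - r * t * wa1 E)"


section \<open>The group of points and the rank\<close>

datatype 'a point = Infinity | Affine 'a 'a

fun on_curve :: "'a::field weierstrass \<Rightarrow> 'a point \<Rightarrow> bool" where
  "on_curve E Infinity \<longleftrightarrow> True"
| "on_curve E (Affine x y) \<longleftrightarrow>
     y ^ 2 + wa1 E * x * y + wa3 E * y = x ^ 3 + wa2 E * x ^ 2 + wa4 E * x + wa6 E"

text \<open>The chord-tangent law; \<open>l\<close> is the slope of the line through the two points.\<close>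

fun point_add :: "'a::field weierstrass \<Rightarrow> 'a point \<Rightarrow> 'a point \<Rightarrow> 'a point" where
  "point_add E Infinity Q = Q"
| "point_add E P Infinity = P"
| "point_add E (Affine x1 y1) (Affine x2 y2) =
    (if x1 = x2 \<and> y1 + y2 + wa1 E * x2 + wa3 E = 0 then Infinity
     else
       let l = (if x1 = x2
                then (3 * x1 ^ 2 + 2 * wa2 E * x1 + wa4 E - wa1 E * y1)
                       / (2 * y1 + wa1 E * x1 + wa3 E)
                else (y2 - y1) / (x2 - x1));
           x3 = l ^ 2 + wa1 E * l - wa2 E - x1 - x2
       in Affine x3 (- (l * (x3 - x1) + y1) - wa1 E * x3 - wa3 E))"

definition point_group :: "'a::field weierstrass \<Rightarrow> 'a point monoid" where
  "point_group E = \<lparr>carrier = {P. on_curve E P}, monoid.mult = point_add E, one = Infinity\<rparr>"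

definition int_independent :: "('a, 'm) monoid_scheme \<Rightarrow> 'a set \<Rightarrow> bool" where
  "int_independent G S \<longleftrightarrow> finite S \<and> S \<subseteq> carrier G \<and>
     (\<forall>m :: 'a \<Rightarrow> int.
        (\<Otimes>\<^bsub>G\<^esub>P\<in>S. P [^]\<^bsub>G\<^esub> m P) = \<one>\<^bsub>G\<^esub> \<longrightarrow> (\<forall>P\<in>S. m P = 0))"

text \<open>The value is taken in \<^typ>\<open>enat\<close> so that the definition does not presuppose the
  Mordell-Weil theorem.\<close>

definition mw_rank :: "rat weierstrass \<Rightarrow> enat" where
  "mw_rank E = (SUP S\<in>{S. int_independent (point_group E) S}. enat (card S))"


section \<open>The minimal discriminant\<close>

definition integral_models :: "rat weierstrass \<Rightarrow> int weierstrass set" where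
  "integral_models E = {W. weierstrass_iso E (map_weierstrass of_int W)}"

text \<open>An equation minimal at \<open>p\<close>. Restricting to models over the integers rather than over the
  localization at \<open>p\<close> does not change the minimum: denominators prime to \<open>p\<close> are removed by a
  scaling with \<open>u\<close> a unit at \<open>p\<close>.\<close>

definition minimal_model :: "nat \<Rightarrow> rat weierstrass \<Rightarrow> int weierstrass" where
  "minimal_model p E =
     arg_min (\<lambda>W. multiplicity (int p) (discriminant W)) (\<lambda>W. W \<in> integral_models E)"

definition bad_primes :: "rat weierstrass \<Rightarrow> nat set" where
  "bad_primes E = {p. normalization_semidom_class.prime p \<and> int p dvd discriminant (minimal_model p E)}"

text \<open>The absolute value of the minimal discriminant, that is, the positive generator of the
  minimal discriminant ideal.\<close>

definition minimal_discriminant :: "rat weierstrass \<Rightarrow> nat" where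
  "minimal_discriminant E =
     (\<Prod>p\<in>bad_primes E. p ^ multiplicity (int p) (discriminant (minimal_model p E)))"


section \<open>The conductor\<close>

text \<open>Codimension of the inertia invariants of the Tate module: 0 for good, 1 for multiplicative
  (reduced curve with a node) and 2 for additive reduction (cusp). The singular point
  of a reduced curve with vanishing discriminant is a node iff \<open>c\<^sub>4\<close> does not vanish.\<close>

definition tame_exponent :: "nat \<Rightarrow> rat weierstrass \<Rightarrow> nat" where
  "tame_exponent p E =
     (let W = minimal_model p E in
      if \<not> int p dvd discriminant W then 0
      else if \<not> int p dvd wc4 W then 1
      else 2)"

text \<open>Torsion points over the algebraic closure of the rationals, seen as points over the complex
  numbers (every complex torsion point has algebraic coordinates).\<close>

definition torsion :: "rat weierstrass \<Rightarrow> nat \<Rightarrow> complex point set" where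
  "torsion E n =
     (let G = point_group (map_weierstrass of_rat E)
      in {P \<in> carrier G. P [^]\<^bsub>G\<^esub> n = \<one>\<^bsub>G\<^esub>})"

definition torsion_field :: "rat weierstrass \<Rightarrow> nat \<Rightarrow> complex ring" where
  "torsion_field E n =
     ring_of_type_algebra
       \<lparr>carrier := generate_field ring_of_type_algebra (\<Union>P\<in>torsion E n. set_point P)\<rparr>"

definition integer_ring :: "complex ring \<Rightarrow> complex ring" where
  "integer_ring K = K\<lparr>carrier := {x \<in> carrier K. algebraic_int x}\<rparr>"

definition automorphisms :: "complex ring \<Rightarrow> (complex \<Rightarrow> complex) set" where
  "automorphisms K = ring_iso K K \<inter> extensional (carrier K)"

text \<open>The \<open>i\<close>-th ramification group (lower numbering) of a prime ideal \<open>P\<close> of a number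
  field \<open>K\<close> that is Galois over the rationals. It coincides with the one of the
  completion of \<open>K\<close> at \<open>P\<close>, and membership forces \<open>\<sigma>\<close> into the decomposition group of \<open>P\<close>.\<close>

definition ramification_group ::
    "complex ring \<Rightarrow> complex set \<Rightarrow> nat \<Rightarrow> (complex \<Rightarrow> complex) set" where
  "ramification_group K P i =
     {\<sigma> \<in> automorphisms K. \<forall>x\<in>carrier (integer_ring K).
        \<sigma> x - x \<in> P [^]\<^bsub>ideals_set (integer_ring K)\<^esub> Suc i}"

definition prime_above :: "complex ring \<Rightarrow> nat \<Rightarrow> complex set" where
  "prime_above K p = (SOME P. primeideal P (integer_ring K) \<and> of_nat p \<in> P)"

definition fixed_torsion ::
    "rat weierstrass \<Rightarrow> nat \<Rightarrow> (complex \<Rightarrow> complex) set \<Rightarrow> complex point set" where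
  "fixed_torsion E n H = {P \<in> torsion E n. \<forall>\<sigma>\<in>H. map_point \<sigma> P = P}"

text \<open>The wild part of the conductor exponent, computed from the \<open>l\<close>-torsion for a prime
  \<open>l \<noteq> p\<close>:
    \<open>\<delta> = (\<Sum>i\<ge>1. |G\<^sub>i| / |G\<^sub>0| * dim (E[l] / E[l]\<^bsup>G\<^sub>i\<^esup>))\<close>,
  where the dimension over the field with \<open>l\<close> elements is the logarithm to base \<open>l\<close> of the
  cardinality. Only finitely many terms are nonzero, as \<open>G\<^sub>i\<close> is trivial for large \<open>i\<close>.\<close>

definition wild_exponent_at :: "nat \<Rightarrow> nat \<Rightarrow> rat weierstrass \<Rightarrow> real" where
  "wild_exponent_at l p E =
     (let K = torsion_field E l;
          G = ramification_group K (prime_above K p)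
      in suminf (\<lambda>i. real (card (G (Suc i))) / real (card (G 0)) *
           log (real l) (real (card (torsion E l)) / real (card (fixed_torsion E l (G (Suc i)))))))"

text \<open>The value does not depend on the auxiliary prime \<open>l \<noteq> p\<close>, nor on the prime above \<open>p\<close>.\<close>

definition wild_exponent :: "nat \<Rightarrow> rat weierstrass \<Rightarrow> real" where
  "wild_exponent p E = wild_exponent_at (if p = 2 then 3 else 2) p E"

text \<open>The exponents are integers, but this is a theorem; hence the real-valued type. At primes of
  good reduction both parts of the exponent vanish (Neron-Ogg-Shafarevich).\<close>

definition conductor :: "rat weierstrass \<Rightarrow> real" where
  "conductor E =
     (\<Prod>p\<in>bad_primes E. real p powr (real (tame_exponent p E) + wild_exponent p E))"


section \<open>The two conjectures\<close>

definition szpiro_conjecture :: bool where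
  "szpiro_conjecture \<longleftrightarrow> (\<forall>\<epsilon>::real. \<epsilon> > 0 \<longrightarrow>
     finite ({E :: rat weierstrass. elliptic E \<and>
               ln (real (minimal_discriminant E)) / ln (conductor E) \<ge> 6 + \<epsilon>}
             // {(E, E'). weierstrass_iso E E'}))"

definition neron_conjecture :: bool where
  "neron_conjecture \<longleftrightarrow>
     (\<exists>R :: nat. \<forall>E :: rat weierstrass. elliptic E \<longrightarrow> mw_rank E \<le> enat R)"


section \<open>Diophantine graphs\<close>

definition omega :: "int \<Rightarrow> nat" where
  "omega d = card (prime_factors d)"

definition diophantine_graph :: "int set \<Rightarrow> int pair_pre_digraph" where
  "diophantine_graph V =
     \<lparr>pverts = V, parcs = {(a, b). a \<in> V \<and> b \<in> V \<and> a \<noteq> b \<and> is_square (a * b + 1)}\<rparr>"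

text \<open>One of the two vertex classes in a presentation of \<open>G\<close> as a complete bipartite graph, in the
  sense of \<^const>\<open>complete_bipartite_digraph\<close>.\<close>

definition vertex_class :: "('a, 'b) pre_digraph \<Rightarrow> 'a set \<Rightarrow> bool" where
  "vertex_class G U \<longleftrightarrow>
     (\<exists>W. verts G = U \<union> W \<and> U \<inter> W = {} \<and> arcs_ends G = U \<times> W \<union> W \<times> U)"

end

(* Let U, W be the two vertex classes, so that u * w + 1 is a square for all u in U and w in W.
   Enumerated increasingly as u_i and w_i, they admit an absolute bound t < 55.

   Gap principle. For a < b < c in U and d < e < f in W the 3x3 matrix of the integers
   sqrt(u * w + 1) is nearly of rank one, so its determinant is small, yet it is nonzero because
   its rows lie on a nondegenerate conic. This gives 2 a^3 d e <= 9 b c f, and together with the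
   same inequality for W and U it makes u_i * w_i grow doubly exponentially in i.

   Hypergeometric method. Let X_u = sqrt(u * e + 1), Y_u = sqrt(u * f + 1) for u in {a, b, c}.
   The divided difference of (1 - z / M)^(k + 1/2), with three nodes of multiplicity k + 1 each,
   yields integers r_u for which the sum of r_u X_u Y_u lies strictly between 0 and 1 in absolute
   value as soon as f lies in a certain window between powers of e, which is absurd. For e >= c^400
   the windows for varying k cover all f >= e^42. Hence all but boundedly many w are below c^400,
   where c is the third smallest element of U, and symmetrically. This contradicts the doubly
   exponential growth of u_i * w_i when t is large. *)

theory Submission
  imports Defs "HOL-Analysis.Generalised_Binomial_Theorem"
begin

section \<open>Binomial coefficients of half-integers\<close>

lemma Suc_mult_gbinomial_Suc:
  "real (Suc n) * (a gchoose Suc n) = (a - real n) * (a gchoose n)"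
  using gbinomial_mult_1[of a n] by (simp add: algebra_simps)

text \<open>Both sides obey the same first-order recurrence in \<open>l\<close>. The exponent
  \<open>-1/2\<close> is the start of the inductions on \<open>k\<close> for the exponents
  \<open>k - 1/2\<close> below.\<close>

lemma four_power_gbinomial_minus_half:
  "4 ^ l * ((- 1/2 :: real) gchoose l) = (- 1) ^ l * real (2 * l choose l)"
proof (induction l)
  case (Suc l)
  have c: "real (Suc l) * real (2 * Suc l choose Suc l) = 2 * (2 * l + 1) * real (2 * l choose l)"
  proof -
    have "fact (2 * Suc l) = (2 * real (Suc l)) * (2 * real l + 1) * (fact (2 * l) :: real)"
      by (simp add: algebra_simps)
    moreover have "2 * Suc l - Suc l = Suc l" "2 * l - l = l" by auto
    ultimately show ?thesis
      by (simp add: binomial_fact divide_simps del: binomial_Suc_Suc fact_Suc) (simp add: algebra_simps)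
  qed
  have "real (Suc l) * (4 ^ Suc l * ((- 1/2 :: real) gchoose Suc l))
      = 4 * (- 1/2 - real l) * (4 ^ l * ((- 1/2 :: real) gchoose l))"
    using arg_cong[OF Suc_mult_gbinomial_Suc[of l "-1/2"], of "\<lambda>t. 4 ^ Suc l * t"]
    by (simp only: power_Suc mult_ac)
  also have "\<dots> = real (Suc l) * ((- 1) ^ Suc l * real (2 * Suc l choose Suc l))"
    using arg_cong[OF c, of "\<lambda>t. (- 1) ^ Suc l * t"] unfolding Suc.IH
    by (simp add: algebra_simps del: binomial_Suc_Suc)
  finally show ?case by (rule mult_left_cancel[THEN iffD1, rotated]) simp
qed simp

lemma half_integer_Suc: "real (Suc k) - 1/2 = (real k - 1/2) + 1"
  by simp

text \<open>Pascal's rule raises the exponent by one and preserves integrality, starting from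
  central binomial coefficients.\<close>

lemma gbinomial_half_integer_Ints: "4 ^ l * ((real k - 1/2) gchoose l) \<in> \<int>"
proof (induction k arbitrary: l)
  case 0
  then show ?case using four_power_gbinomial_minus_half[of l] by simp
next
  case (Suc k)
  show ?case
  proof (cases l)
    case (Suc j)
    have "4 ^ l * ((real (Suc k) - 1/2) gchoose l)
        = 4 * (4 ^ j * ((real k - 1/2) gchoose j)) + 4 ^ l * ((real k - 1/2) gchoose l)"
      unfolding half_integer_Suc Suc gbinomial_Suc_Suc by (simp add: algebra_simps)
    then show ?thesis using Suc.IH[of j] Suc.IH[of l] by simp
  qed simp
qed

text \<open>The modulus is at most 1 for exponent \<open>-1/2\<close>, and Pascal's rule at most
  doubles it with each step in \<open>k\<close>.\<close>

lemma gbinomial_half_integer_le: "\<bar>(real k - 1/2) gchoose l\<bar> \<le> 2 ^ k"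
proof (induction k arbitrary: l)
  case 0
  have "real (2 * l choose l) \<le> 4 ^ l"
    using binomial_le_pow2[of "2 * l" l] by (metis numeral_power_eq_of_nat_cancel_iff of_nat_le_iff power2_eq_square power_mult mult_2 numeral_Bit0)
  then have "4 ^ l * \<bar>(- 1/2 :: real) gchoose l\<bar> \<le> 4 ^ l * 1"
    using four_power_gbinomial_minus_half[of l]
    by (metis abs_mult abs_neg_one abs_of_nat abs_power_minus abs_numeral mult.right_neutral mult_1 power_abs power_one)
  then show ?case by simp
next
  case (Suc k)
  show ?case
  proof (cases l)
    case (Suc j)
    show ?thesis
      unfolding half_integer_Suc Suc gbinomial_Suc_Suc using Suc.IH[of j] Suc.IH[of "Suc j"] by simp
  next
    case 0
    then show ?thesis using one_le_power[of "2::real" "Suc k"] by simp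
  qed
qed

text \<open>A zero factor would make \<open>k - 1/2\<close> a natural number, which parity
  forbids.\<close>

lemma gbinomial_half_integer_nonzero: "(real k - 1/2) gchoose l \<noteq> 0"
proof
  assume "(real k - 1/2) gchoose l = 0"
  then obtain i where "real k - 1/2 = real i"
    by (auto simp: gbinomial_prod_rev)
  then have "real (2 * k) = real (2 * i + 1)" by simp
  then show False unfolding of_nat_eq_iff by presburger
qed

lemma gbinomial_half_integer_ge: "1 / 4 ^ l \<le> \<bar>(real k - 1/2) gchoose l\<bar>"
proof -
  obtain z :: int where z: "4 ^ l * ((real k - 1/2) gchoose l) = of_int z"
    using gbinomial_half_integer_Ints Ints_cases by metis
  have "z \<noteq> 0" using z gbinomial_half_integer_nonzero[of k l] by auto
  then have "1 \<le> \<bar>4 ^ l * ((real k - 1/2) gchoose l)\<bar>" unfolding z by linarith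
  then show ?thesis by (simp add: abs_mult field_simps)
qed

text \<open>At \<open>n = k\<close> all factors are positive, and every later factor
  \<open>k - 1/2 - n\<close> is negative. This rules out cancellation in the series of the divided
  difference.\<close>

lemma gbinomial_half_integer_sign:
  assumes "k \<le> n"
  shows "(- 1) ^ (n + k) * ((real k - 1/2) gchoose n) > 0"
  using assms
proof (induction n rule: dec_induct)
  case base
  have "(real k - 1/2) gchoose k > 0" 
    unfolding gbinomial_prod_rev by (intro divide_pos_pos prod_pos) auto
  then show ?case by simp
next
  case (step n)
  have "real (Suc n) * ((- 1) ^ (Suc n + k) * ((real k - 1/2) gchoose Suc n))
      = - ((- 1) ^ (n + k) * (real (Suc n) * ((real k - 1/2) gchoose Suc n)))"
    by (simp add: mult_ac)
  also have "\<dots> = (real n + 1/2 - real k) * ((- 1) ^ (n + k) * ((real k - 1/2) gchoose n))"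
    unfolding Suc_mult_gbinomial_Suc by (simp add: algebra_simps)
  also have "\<dots> > 0" using step by (intro mult_pos_pos[OF _ step.IH]) simp
  finally show ?case by (rule zero_less_mult_pos) simp
qed


section \<open>Divided differences of half-integral powers\<close>

definition geom :: "real \<Rightarrow> real fps" where
  "geom g = inverse (1 - fps_const g * fps_X)"

lemma geom_power_nth: "fps_nth (geom g ^ Suc l) n = real ((l + n) choose n) * g ^ n"
  unfolding geom_def using one_minus_const_fps_X_neg_power'[of "Suc l" g]
  by (simp only: fps_inverse_power fps_nth_Abs_fps) simp

lemma geom_nth: "fps_nth (geom g) n = g ^ n"
  using geom_power_nth[of g 0 n] by simp

lemma geom_mult: "geom g * (1 - fps_const g * fps_X) = 1"
  unfolding geom_def by (rule inverse_mult_eq_1) simp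

text \<open>Partial fractions for two geometric series.\<close>

lemma geom_diff:
  "fps_const (g - h) * fps_X * (geom g * geom h) = geom g - geom h"
proof -
  have "geom g - geom h = geom g * (geom h * (1 - fps_const h * fps_X))
      - geom h * (geom g * (1 - fps_const g * fps_X))"
    by (simp add: geom_mult)
  also have "\<dots> = (fps_const g - fps_const h) * fps_X * (geom g * geom h)"
    by (simp add: algebra_simps del: fps_const_sub)
  finally show ?thesis by (simp only: fps_const_sub)
qed

text \<open>The coefficient of \<open>X\<^sup>n\<close> is the divided difference of \<open>z\<^sup>n\<close> at the nodes \<open>g i\<close> taken with
  multiplicities \<open>m i\<close> (a complete homogeneous symmetric polynomial). Pairing with the binomial series
  below gives the divided difference of \<open>(1 - x * z) powr \<kappa>\<close>. The multiplicities must not all be 0.\<close>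

definition node_fps :: "'i set \<Rightarrow> ('i \<Rightarrow> real) \<Rightarrow> ('i \<Rightarrow> nat) \<Rightarrow> real fps" where
  "node_fps I g m = fps_X ^ ((\<Sum>i\<in>I. m i) - 1) * (\<Prod>i\<in>I. geom (g i) ^ m i)"

lemma sum_fun_upd_Suc:
  assumes "finite I" "i \<in> I"
  shows "(\<Sum>k\<in>I. (n(i := Suc (n i))) k) = Suc (\<Sum>k\<in>I. n k)"
  using assms by (simp add: sum.remove)

lemma prod_fun_upd_Suc:
  fixes f :: "'i \<Rightarrow> 'a::comm_monoid_mult"
  assumes "finite I" "i \<in> I"
  shows "(\<Prod>k\<in>I. f k ^ (n(i := Suc (n i))) k) = f i * (\<Prod>k\<in>I. f k ^ n k)"
proof -
  have "(\<Prod>k\<in>I. f k ^ (n(i := Suc (n i))) k) = f i ^ Suc (n i) * (\<Prod>k\<in>I - {i}. f k ^ n k)"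
    using assms by (simp add: prod.remove)
  also have "\<dots> = f i * (\<Prod>k\<in>I. f k ^ n k)"
    using assms by (simp add: prod.remove mult.assoc)
  finally show ?thesis .
qed

text \<open>The recursion of divided differences, which is \<open>geom_diff\<close> in disguise:
  raising both multiplicities adds one to the total, and the extra \<open>fps_X\<close> is the one
  that the partial fractions consume.\<close>

lemma node_fps_diff:
  assumes "finite I" "i \<in> I" "j \<in> I" "i \<noteq> j"
  shows "fps_const (g i - g j) * node_fps I g (n(i := Suc (n i), j := Suc (n j)))
    = node_fps I g (n(i := Suc (n i))) - node_fps I g (n(j := Suc (n j)))"
proof -
  define S where "S = (\<Sum>k\<in>I. n k)"
  define Q where "Q = (\<Prod>k\<in>I. geom (g k) ^ n k)"
  let ?n = "n(i := Suc (n i))"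
  have "n(i := Suc (n i), j := Suc (n j)) = ?n(j := Suc (?n j))" using assms by auto
  then have 1: "node_fps I g (n(i := Suc (n i), j := Suc (n j)))
      = fps_X ^ Suc S * (geom (g j) * (geom (g i) * Q))"
    unfolding node_fps_def
    using prod_fun_upd_Suc[OF assms(1,3), of "\<lambda>k. geom (g k)" ?n]
      prod_fun_upd_Suc[OF assms(1,2), of "\<lambda>k. geom (g k)" n]
      sum_fun_upd_Suc[OF assms(1,3), of ?n] sum_fun_upd_Suc[OF assms(1,2), of n]
    by (simp only: Q_def S_def diff_Suc_1)
  have 2: "node_fps I g (n(k := Suc (n k))) = fps_X ^ S * (geom (g k) * Q)" if "k \<in> I" for k
    unfolding node_fps_def sum_fun_upd_Suc[OF assms(1) that]
      prod_fun_upd_Suc[OF assms(1) that, of "\<lambda>k. geom (g k)"]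
      Q_def S_def by simp
  have "fps_const (g i - g j) * node_fps I g (n(i := Suc (n i), j := Suc (n j)))
      = fps_X ^ S * Q * (fps_const (g i - g j) * fps_X * (geom (g i) * geom (g j)))"
    unfolding 1 by (simp add: algebra_simps)
  also have "\<dots> = fps_X ^ S * (geom (g i) * Q) - fps_X ^ S * (geom (g j) * Q)"
    unfolding geom_diff by (simp add: algebra_simps)
  finally show ?thesis using 2 assms by simp
qed

section \<open>Evaluation of power series with nonnegative coefficients\<close>

definition nonneg_eval :: "real \<Rightarrow> real fps \<Rightarrow> real \<Rightarrow> bool" where
  "nonneg_eval x F v \<longleftrightarrow> (\<forall>n. fps_nth F n \<ge> 0) \<and> (\<lambda>n. fps_nth F n * x ^ n) sums v"

text \<open>Series with nonnegative terms converge absolutely, so the Cauchy product applies; this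
  is the purpose of the sign condition in \<open>nonneg_eval\<close>.\<close>

lemma nonneg_eval_mult:
  assumes F: "nonneg_eval x F u" and G: "nonneg_eval x G v" and x: "x \<ge> 0"
  shows "nonneg_eval x (F * G) (u * v)"
proof -
  have "(\<lambda>k. \<Sum>i\<le>k. (fps_nth F i * x ^ i) * (fps_nth G (k - i) * x ^ (k - i))) sums (u * v)"
    using Cauchy_product_sums[of "\<lambda>n. fps_nth F n * x ^ n" "\<lambda>n. fps_nth G n * x ^ n"] F G x
    unfolding nonneg_eval_def by (auto simp: sums_iff)
  also have "(\<lambda>k. \<Sum>i\<le>k. (fps_nth F i * x ^ i) * (fps_nth G (k - i) * x ^ (k - i)))
      = (\<lambda>k. fps_nth (F * G) k * x ^ k)"
  proof
    fix k
    have "(fps_nth F i * x ^ i) * (fps_nth G (k - i) * x ^ (k - i))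
        = fps_nth F i * fps_nth G (k - i) * x ^ k" if "i \<le> k" for i
      using power_add[of x i "k - i"] that by (simp add: mult_ac)
    then show "(\<Sum>i\<le>k. (fps_nth F i * x ^ i) * (fps_nth G (k - i) * x ^ (k - i)))
        = fps_nth (F * G) k * x ^ k"
      unfolding fps_mult_nth atLeast0AtMost sum_distrib_right by (intro sum.cong) auto
  qed
  finally show ?thesis
    using F G unfolding nonneg_eval_def by (auto simp: fps_mult_nth intro!: sum_nonneg)
qed

lemma nonneg_eval_1: "nonneg_eval x 1 1"
proof -
  have "(\<lambda>n. fps_nth 1 n * x ^ n) sums (\<Sum>n\<in>{0}. fps_nth 1 n * x ^ n)"
    by (rule sums_finite) auto
  then show ?thesis unfolding nonneg_eval_def by auto
qed

lemma nonneg_eval_X: "nonneg_eval x fps_X x"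
proof -
  have "(\<lambda>n. fps_nth fps_X n * x ^ n) sums (\<Sum>n\<in>{1}. fps_nth fps_X n * x ^ n)"
    by (rule sums_finite) auto
  then show ?thesis unfolding nonneg_eval_def by auto
qed

lemma nonneg_eval_geom:
  assumes "0 \<le> x" "0 \<le> g" "g * x < 1"
  shows "nonneg_eval x (geom g) (1 / (1 - g * x))"
  using geometric_sums[of "g * x"] assms
  unfolding nonneg_eval_def by (auto simp: geom_nth power_mult_distrib)

lemma nonneg_eval_power:
  "nonneg_eval x F u \<Longrightarrow> x \<ge> 0 \<Longrightarrow> nonneg_eval x (F ^ n) (u ^ n)"
  by (induction n) (auto intro: nonneg_eval_mult nonneg_eval_1)

lemma nonneg_eval_prod:
  assumes "\<And>i. i \<in> I \<Longrightarrow> nonneg_eval x (F i) (u i)" "x \<ge> 0"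
  shows "nonneg_eval x (\<Prod>i\<in>I. F i) (\<Prod>i\<in>I. u i)"
  using assms(1)
  by (induction I rule: infinite_finite_induct) (auto intro: nonneg_eval_mult nonneg_eval_1 assms(2))

lemma nonneg_eval_node_fps:
  assumes "x \<ge> 0" "\<And>i. i \<in> I \<Longrightarrow> 0 \<le> g i \<and> g i * x < 1"
  shows "nonneg_eval x (node_fps I g m)
    (x ^ ((\<Sum>i\<in>I. m i) - 1) * (\<Prod>i\<in>I. (1 / (1 - g i * x)) ^ m i))"
  unfolding node_fps_def using assms
  by (intro nonneg_eval_mult nonneg_eval_power nonneg_eval_X nonneg_eval_prod nonneg_eval_geom) auto

section \<open>Pairing with the binomial series\<close>

definition binomial_pairing :: "real \<Rightarrow> real \<Rightarrow> real fps \<Rightarrow> real" where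
  "binomial_pairing \<kappa> x F = suminf (\<lambda>n. (- 1) ^ n * (\<kappa> gchoose n) * (fps_nth F n * x ^ n))"

lemma summable_binomial_pairing:
  assumes "nonneg_eval x F v" "x \<ge> 0"
  shows "summable (\<lambda>n. (- 1) ^ n * ((real k - 1/2) gchoose n) * (fps_nth F n * x ^ n))"
proof (rule summable_comparison_test')
  show "summable (\<lambda>n. 2 ^ k * (fps_nth F n * x ^ n))"
    using assms unfolding nonneg_eval_def by (auto simp: sums_iff)
  show "norm ((- 1) ^ n * ((real k - 1/2) gchoose n) * (fps_nth F n * x ^ n))
      \<le> 2 ^ k * (fps_nth F n * x ^ n)" if "n \<ge> 0" for n
    using gbinomial_half_integer_le[of k n] assms
    unfolding nonneg_eval_def by (auto simp: abs_mult power_abs intro!: mult_right_mono)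
qed

lemma binomial_pairing_node_fps_diff:
  assumes I: "finite I" "i \<in> I" "j \<in> I" "i \<noteq> j"
    and x: "x \<ge> 0" "\<And>i. i \<in> I \<Longrightarrow> 0 \<le> g i \<and> g i * x < 1"
  shows "(g i - g j) * binomial_pairing (real k - 1/2) x (node_fps I g (n(i := Suc (n i), j := Suc (n j))))
    = binomial_pairing (real k - 1/2) x (node_fps I g (n(i := Suc (n i))))
      - binomial_pairing (real k - 1/2) x (node_fps I g (n(j := Suc (n j))))"
proof -
  note s = summable_binomial_pairing[OF nonneg_eval_node_fps[OF x] x(1)]
  have "(g i - g j) * fps_nth (node_fps I g (n(i := Suc (n i), j := Suc (n j)))) l
     = fps_nth (node_fps I g (n(i := Suc (n i)))) l - fps_nth (node_fps I g (n(j := Suc (n j)))) l"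
    (is "_ * ?A l = ?B l - ?C l") for l
    using arg_cong[OF node_fps_diff[OF I, of g n], of "\<lambda>F. fps_nth F l"] by simp
  note diff = this
  have e: "(g i - g j) * ((- 1) ^ l * ((real k - 1/2) gchoose l) * (?A l * x ^ l))
     = (- 1) ^ l * ((real k - 1/2) gchoose l) * (?B l * x ^ l)
     - (- 1) ^ l * ((real k - 1/2) gchoose l) * (?C l * x ^ l)" for l
  proof -
    have "a * (c * (A * p)) = c * (B * p) - c * (C * p)" if "a * A = B - C" for a c A B C p :: real
      using arg_cong[OF that, of "\<lambda>t. c * (t * p)"] by (simp add: algebra_simps)
    from this[OF diff] show ?thesis .
  qed
  have "(g i - g j) * suminf (\<lambda>l. (- 1) ^ l * ((real k - 1/2) gchoose l) * (?A l * x ^ l))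
     = suminf (\<lambda>l. (g i - g j) * ((- 1) ^ l * ((real k - 1/2) gchoose l) * (?A l * x ^ l)))"
    by (rule suminf_mult[OF s, symmetric]) auto
  also have "\<dots> = suminf (\<lambda>l. (- 1) ^ l * ((real k - 1/2) gchoose l) * (?B l * x ^ l)
     - (- 1) ^ l * ((real k - 1/2) gchoose l) * (?C l * x ^ l))"
    by (simp only: e)
  also have "\<dots> = suminf (\<lambda>l. (- 1) ^ l * ((real k - 1/2) gchoose l) * (?B l * x ^ l))
     - suminf (\<lambda>l. (- 1) ^ l * ((real k - 1/2) gchoose l) * (?C l * x ^ l))"
    by (rule suminf_diff[OF s s, symmetric]) auto
  finally show ?thesis unfolding binomial_pairing_def .
qed

text \<open>A node of multiplicity \<open>l + 1\<close> yields the Taylor coefficient of order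
  \<open>l\<close> at \<open>g\<close> of the function \<open>(1 - x * z) powr \<kappa>\<close> of
  \<open>z\<close>. Trinomial revision turns the series into the binomial series with exponent
  \<open>\<kappa> - l\<close>.\<close>

lemma binomial_pairing_single_node:
  assumes "0 \<le> g" "0 \<le> x" "g * x < 1"
  shows "binomial_pairing \<kappa> x (fps_X ^ l * geom g ^ Suc l)
    = (- x) ^ l * (\<kappa> gchoose l) * (1 - g * x) powr (\<kappa> - real l)"
proof -
  have "(\<lambda>j. (- x) ^ l * (\<kappa> gchoose l) * (((\<kappa> - real l) gchoose j) * (- (g * x)) ^ j))
     sums ((- x) ^ l * (\<kappa> gchoose l) * (1 + - (g * x)) powr (\<kappa> - real l))"
    using assms by (intro sums_mult gen_binomial_real) auto
  also have "(\<lambda>j. (- x) ^ l * (\<kappa> gchoose l) * (((\<kappa> - real l) gchoose j) * (- (g * x)) ^ j))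
    = (\<lambda>j. (- 1) ^ (j + l) * (\<kappa> gchoose (j + l))
        * (fps_nth (fps_X ^ l * geom g ^ Suc l) (j + l) * x ^ (j + l)))"
  proof
    fix j
    have "(\<kappa> gchoose (j + l)) * real ((l + j) choose j) = (\<kappa> gchoose l) * ((\<kappa> - real l) gchoose j)"
      using gbinomial_trinomial_revision[of l "j + l" \<kappa>] binomial_symmetric[of j "l + j"]
      by (simp add: binomial_gbinomial add.commute)
    moreover have "fps_nth (fps_X ^ l * geom g ^ Suc l) (j + l) = real ((l + j) choose j) * g ^ j"
      by (simp only: fps_X_power_mult_nth geom_power_nth) simp
    ultimately show "(- x) ^ l * (\<kappa> gchoose l) * (((\<kappa> - real l) gchoose j) * (- (g * x)) ^ j)
      = (- 1) ^ (j + l) * (\<kappa> gchoose (j + l))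
        * (fps_nth (fps_X ^ l * geom g ^ Suc l) (j + l) * x ^ (j + l))"
      by (simp add: power_add power_minus[of x] power_minus[of "g * x"] power_mult_distrib mult_ac)
  qed
  \<comment> \<open>The factor \<open>fps_X ^ l\<close> kills the first \<open>l\<close>
    coefficients, so the shifted series has the same sum.\<close>
  also have "\<dots> sums v \<longleftrightarrow> (\<lambda>n. (- 1) ^ n * (\<kappa> gchoose n)
        * (fps_nth (fps_X ^ l * geom g ^ Suc l) n * x ^ n)) sums v" for v
    by (rule sums_zero_iff_shift) (simp only: fps_X_power_mult_nth, simp)
  finally show ?thesis unfolding binomial_pairing_def by (simp add: sums_iff)
qed

text \<open>For \<open>x = 1 / M\<close> the power is \<open>((M - g) / M) ^ (k - l)\<close> times a
  square root, so \<open>(4 * M) ^ k\<close> clears all denominators. The bound collects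
  \<open>4 ^ k\<close>, \<open>2 ^ Suc k\<close> and \<open>M ^ k\<close>.\<close>

lemma binomial_pairing_single_node_integer:
  fixes M g :: int
  assumes g: "0 \<le> g" "g < M" and l: "l \<le> k"
  shows "\<exists>z :: int. \<bar>z\<bar> \<le> 2 * (8 * M) ^ k \<and>
    (4 * of_int M) ^ k * binomial_pairing (real (Suc k) - 1/2) (1 / of_int M)
       (fps_X ^ l * geom (of_int g) ^ Suc l) = of_int z * sqrt (1 - of_int g / of_int M)"
proof -
  let ?C = "(real (Suc k) - 1/2) gchoose l"
  let ?y = "1 - real_of_int g / of_int M"
  obtain b :: int where b: "4 ^ l * ?C = of_int b"
    using gbinomial_half_integer_Ints Ints_cases by metis
  have M: "M > 0" using g by simp
  then have y: "?y > 0" using g by simp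
  define z where "z = (- 1) ^ l * 4 ^ (k - l) * b * (M - g) ^ (k - l)"
  have e: "real (Suc k) - 1/2 - real l = real (k - l) + 1/2" using l by (simp add: of_nat_diff)
  have powr: "?y powr (real (k - l) + 1/2) = ?y ^ (k - l) * sqrt ?y"
    using y by (simp add: powr_add powr_realpow powr_half_sqrt)
  have Mk: "real_of_int M ^ k = of_int M ^ l * of_int M ^ (k - l)"
    and fk: "(4::real) ^ k = 4 ^ l * 4 ^ (k - l)"
    using l by (simp_all flip: power_add)
  have My: "of_int M ^ (k - l) * ?y ^ (k - l) = real_of_int (M - g) ^ (k - l)"
    using M by (simp add: right_diff_distrib flip: power_mult_distrib)
  have Ml: "of_int M ^ l * (- (1 / real_of_int M)) ^ l = (- 1) ^ l"
    using M by (simp flip: power_mult_distrib)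
  have "(4 * real_of_int M) ^ k * binomial_pairing (real (Suc k) - 1/2) (1 / of_int M)
       (fps_X ^ l * geom (of_int g) ^ Suc l)
    = (4 * real_of_int M) ^ k * ((- (1 / of_int M)) ^ l * ?C * (?y ^ (k - l) * sqrt ?y))"
    using binomial_pairing_single_node[of "of_int g" "1 / of_int M" "real (Suc k) - 1/2" l] g M
    unfolding e by (simp add: powr)
  also have "\<dots> = (of_int M ^ l * (- (1 / real_of_int M)) ^ l) * 4 ^ (k - l) * (4 ^ l * ?C)
     * (of_int M ^ (k - l) * ?y ^ (k - l)) * sqrt ?y"
    unfolding power_mult_distrib Mk fk by (simp only: mult_ac)
  also have "\<dots> = of_int z * sqrt ?y"
    unfolding Ml My b z_def by simp
  finally have 1: "(4 * of_int M) ^ k * binomial_pairing (real (Suc k) - 1/2) (1 / of_int M)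
       (fps_X ^ l * geom (of_int g) ^ Suc l) = of_int z * sqrt ?y" .
  have "real_of_int \<bar>z\<bar> = 4 ^ k * \<bar>?C\<bar> * of_int (M - g) ^ (k - l)"
    using g arg_cong[OF b, of abs] unfolding z_def fk by (simp add: abs_mult power_abs mult_ac)
  also have "\<dots> \<le> 4 ^ k * 2 ^ Suc k * of_int M ^ k"
  proof (intro mult_mono gbinomial_half_integer_le)
    have "real_of_int (M - g) ^ (k - l) \<le> of_int M ^ (k - l)" using g by (intro power_mono) auto
    also have "\<dots> \<le> of_int M ^ k" using M by (intro power_increasing) auto
    finally show "real_of_int (M - g) ^ (k - l) \<le> of_int M ^ k" .
  qed (use g in auto)
  also have "\<dots> = of_int (2 * (8 * M) ^ k)"
  proof -
    have "(4::real) ^ k * 2 ^ k = 8 ^ k" by (simp flip: power_mult_distrib)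
    then show ?thesis by (simp add: power_mult_distrib)
  qed
  finally have "\<bar>z\<bar> \<le> 2 * (8 * M) ^ k" by (simp only: of_int_le_iff)
  with 1 show ?thesis by blast
qed

text \<open>Induction on the total multiplicity. While two nodes carry weight, the recursion lowers
  the total at the price of the divisor \<open>g i - g j\<close>, which is paid by one factor
  \<open>D\<close>. Subtracting two forms doubles the coefficient bound, whence
  \<open>2 * \<bar>D\<bar>\<close>. A single node is explicit.\<close>

lemma binomial_pairing_linear_form:
  fixes M D :: int and g :: "'i \<Rightarrow> int"
  assumes I: "finite I" and g: "\<And>i. i \<in> I \<Longrightarrow> 0 \<le> g i \<and> g i < M"
    and D: "D \<noteq> 0" "\<And>i j. i \<in> I \<Longrightarrow> j \<in> I \<Longrightarrow> i \<noteq> j \<Longrightarrow> g i - g j dvd D"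
    and m: "(\<Sum>i\<in>I. m i) \<noteq> 0" "\<And>i. i \<in> I \<Longrightarrow> m i \<le> Suc k"
  shows "\<exists>q :: 'i \<Rightarrow> int. (\<forall>i\<in>I. \<bar>q i\<bar> \<le> (2 * \<bar>D\<bar>) ^ (\<Sum>i\<in>I. m i) * (2 * (8 * M) ^ k)) \<and>
    of_int D ^ (\<Sum>i\<in>I. m i) * ((4 * of_int M) ^ k * binomial_pairing (real (Suc k) - 1/2) (1 / of_int M)
       (node_fps I (\<lambda>i. of_int (g i)) m)) = (\<Sum>i\<in>I. of_int (q i) * sqrt (1 - of_int (g i) / of_int M))"
  using m
proof (induction "\<Sum>i\<in>I. m i" arbitrary: m)
  case (Suc S)
  let ?G = "\<lambda>i. real_of_int (g i)" and ?th = "\<lambda>i. sqrt (1 - real_of_int (g i) / of_int M)"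
  let ?B = "2 * (8 * M) ^ k"
  let ?L = "\<lambda>m. (4 * of_int M) ^ k * binomial_pairing (real (Suc k) - 1/2) (1 / of_int M) (node_fps I ?G m)"
  obtain i where i: "i \<in> I" "m i \<noteq> 0" using Suc.prems(1) by (meson sum.neutral)
  have M: "M > 0" using g[OF i(1)] by simp
  show ?case
  proof (cases "\<exists>j\<in>I. j \<noteq> i \<and> m j \<noteq> 0")
    case True
    then obtain j where j: "j \<in> I" "j \<noteq> i" "m j \<noteq> 0" by blast
    define n where "n = m(i := m i - 1, j := m j - 1)"
    define mi where "mi = n(i := Suc (n i))"
    define mj where "mj = n(j := Suc (n j))"
    have m_eq: "m = n(i := Suc (n i), j := Suc (n j))"
      using i j by (auto simp: n_def fun_eq_iff)
    have "m = mi(j := Suc (mi j))" "m = mj(i := Suc (mj i))"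
      using j(2) by (auto simp: m_eq mi_def mj_def fun_eq_iff)
    then have sums: "S = sum mi I" "S = sum mj I"
      using Suc.hyps(2) sum_fun_upd_Suc[OF I j(1), of mi] sum_fun_upd_Suc[OF I i(1), of mj] by auto
    have "sum mi I \<noteq> 0" "sum mj I \<noteq> 0"
      using sum_fun_upd_Suc[OF I i(1), of n] sum_fun_upd_Suc[OF I j(1), of n] by (auto simp: mi_def mj_def)
    moreover have "mi l \<le> Suc k" "mj l \<le> Suc k" if "l \<in> I" for l
      using Suc.prems(2)[OF that] by (auto simp: mi_def mj_def n_def)
    ultimately obtain qi qj :: "'i \<Rightarrow> int" where
      qi: "\<forall>l\<in>I. \<bar>qi l\<bar> \<le> (2 * \<bar>D\<bar>) ^ S * ?B" "of_int D ^ S * ?L mi = (\<Sum>l\<in>I. of_int (qi l) * ?th l)" and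
      qj: "\<forall>l\<in>I. \<bar>qj l\<bar> \<le> (2 * \<bar>D\<bar>) ^ S * ?B" "of_int D ^ S * ?L mj = (\<Sum>l\<in>I. of_int (qj l) * ?th l)"
      using Suc.hyps(1)[OF sums(1)] Suc.hyps(1)[OF sums(2)] unfolding sums[symmetric] by blast
    obtain d where d: "D = (g i - g j) * d" using D(2)[OF i(1) j(1)] j(2) by (auto elim: dvdE)
    have gd: "g i - g j \<noteq> 0" using d D(1) by auto
    have "\<bar>d\<bar> * 1 \<le> \<bar>d\<bar> * \<bar>g i - g j\<bar>" using gd by (intro mult_left_mono) auto
    then have dD: "\<bar>d\<bar> \<le> \<bar>D\<bar>" unfolding d abs_mult by (simp add: mult.commute)
    have "(?G i - ?G j) * binomial_pairing (real (Suc k) - 1/2) (1 / of_int M) (node_fps I ?G m)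
      = binomial_pairing (real (Suc k) - 1/2) (1 / of_int M) (node_fps I ?G mi)
      - binomial_pairing (real (Suc k) - 1/2) (1 / of_int M) (node_fps I ?G mj)"
      unfolding m_eq mi_def mj_def
      by (rule binomial_pairing_node_fps_diff) (use I i j g M in auto)
    then have L: "(?G i - ?G j) * ?L m = ?L mi - ?L mj"
      by (simp only: mult.left_commute[of "?G i - ?G j"] right_diff_distrib)
    have dr: "real_of_int D = (?G i - ?G j) * of_int d" by (simp add: d)
    have dr': "real_of_int D * (c * u) = of_int d * (c * ((?G i - ?G j) * u))" for c u
      unfolding dr by (simp only: mult_ac)
    have "of_int D ^ Suc S * ?L m = of_int d * (of_int D ^ S * ((?G i - ?G j) * ?L m))"
      unfolding power_Suc mult.assoc by (rule dr')
    also have "\<dots> = of_int d * (of_int D ^ S * ?L mi) - of_int d * (of_int D ^ S * ?L mj)"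
      unfolding L by (simp add: algebra_simps)
    also have "\<dots> = (\<Sum>l\<in>I. of_int (d * (qi l - qj l)) * ?th l)"
      unfolding qi(2) qj(2) by (simp add: sum_distrib_left sum_subtractf algebra_simps)
    finally have 1: "of_int D ^ Suc S * ?L m = (\<Sum>l\<in>I. of_int (d * (qi l - qj l)) * ?th l)" .
    have 2: "\<bar>d * (qi l - qj l)\<bar> \<le> (2 * \<bar>D\<bar>) ^ Suc S * ?B" if "l \<in> I" for l
    proof -
      have "\<bar>qi l - qj l\<bar> \<le> 2 * ((2 * \<bar>D\<bar>) ^ S * ?B)" using qi(1) qj(1) that by fastforce
      then have "\<bar>d * (qi l - qj l)\<bar> \<le> \<bar>D\<bar> * (2 * ((2 * \<bar>D\<bar>) ^ S * ?B))"
        unfolding abs_mult using dD by (intro mult_mono) auto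
      then show ?thesis by (simp add: mult_ac)
    qed
    show ?thesis using 1 2 unfolding Suc.hyps(2)[symmetric] by (intro exI[of _ "\<lambda>l. d * (qi l - qj l)"]) blast
  next
    case False
    then have z: "m j = 0" if "j \<in> I" "j \<noteq> i" for j using that by blast
    have sm: "sum m I = m i" using z I i(1) by (simp add: sum.remove[of I i])
    define l where "l = m i - 1"
    have l: "m i = Suc l" "l \<le> k" using i Suc.prems(2)[OF i(1)] by (auto simp: l_def)
    have "(\<Prod>j\<in>I. geom (?G j) ^ m j) = geom (?G i) ^ m i"
      using z I i(1) by (simp add: prod.remove[of I i])
    then have nf: "node_fps I ?G m = fps_X ^ l * geom (?G i) ^ Suc l"
      unfolding node_fps_def sm l(1) by simp
    obtain w :: int where w: "\<bar>w\<bar> \<le> ?B" "?L m = of_int w * ?th i"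
      using binomial_pairing_single_node_integer[of "g i" M l k] g[OF i(1)] l(2) unfolding nf by blast
    \<comment> \<open>A single node requires no division, so the whole power of \<open>D\<close>
      goes into its coefficient.\<close>
    define q where "q = (\<lambda>j. if j = i then D ^ sum m I * w else 0)"
    have "(\<Sum>j\<in>I. of_int (q j) * ?th j) = of_int (q i) * ?th i"
      using I i(1) by (simp add: sum.remove[of I i] q_def)
    then have 1: "of_int D ^ sum m I * ?L m = (\<Sum>j\<in>I. of_int (q j) * ?th j)"
      unfolding w(2) by (simp add: q_def)
    have "\<bar>D ^ sum m I * w\<bar> \<le> (2 * \<bar>D\<bar>) ^ sum m I * ?B"
      unfolding abs_mult power_abs using w(1) by (intro mult_mono power_mono) auto
    then have "\<forall>j\<in>I. \<bar>q j\<bar> \<le> (2 * \<bar>D\<bar>) ^ sum m I * ?B"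
      using M by (auto simp: q_def)
    with 1 show ?thesis by blast
  qed
qed simp

text \<open>The series starts at the total multiplicity minus one with coefficient 1, and as this is
  at least \<open>k\<close>, all its terms have one sign. The leading term is therefore a lower
  bound. The upper bound replaces binomials by \<open>2 ^ k\<close> and each
  \<open>1 / (1 - g i * x)\<close> by 2.\<close>

lemma binomial_pairing_bounds:
  fixes x :: real
  assumes x: "0 \<le> x" and g: "\<And>i. i \<in> I \<Longrightarrow> 0 \<le> g i \<and> g i * x \<le> 1/2"
    and m: "(\<Sum>i\<in>I. m i) - 1 \<ge> k"
  shows "x ^ ((\<Sum>i\<in>I. m i) - 1) / 4 ^ ((\<Sum>i\<in>I. m i) - 1)
      \<le> \<bar>binomial_pairing (real k - 1/2) x (node_fps I g m)\<bar>"
    and "\<bar>binomial_pairing (real k - 1/2) x (node_fps I g m)\<bar>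
      \<le> 2 ^ k * (x ^ ((\<Sum>i\<in>I. m i) - 1) * 2 ^ (\<Sum>i\<in>I. m i))"
proof -
  define N where "N = (\<Sum>i\<in>I. m i) - 1"
  define F where "F = node_fps I g m"
  define v where "v = x ^ N * (\<Prod>i\<in>I. (1 / (1 - g i * x)) ^ m i)"
  \<comment> \<open>The sign with \<open>n + k\<close> in place of \<open>n\<close> makes the
    nonzero terms positive and changes the sum only by \<open>(- 1) ^ k\<close>.\<close>
  define s where "s = (\<lambda>n. (- 1) ^ (n + k) * ((real k - 1/2) gchoose n))"
  have g': "0 \<le> g i \<and> g i * x < 1" if "i \<in> I" for i using g[OF that] by auto
  have ev: "nonneg_eval x F v"
    unfolding F_def v_def N_def by (rule nonneg_eval_node_fps[OF x g'])
  then have F0: "fps_nth F n \<ge> 0" and Fv: "(\<lambda>n. fps_nth F n * x ^ n) sums v" for n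
    unfolding nonneg_eval_def by auto
  have low: "fps_nth F n = 0" if "n < N" for n
    using that unfolding F_def node_fps_def N_def[symmetric] by (simp add: fps_X_power_mult_nth)
  have gn: "fps_nth (geom y) 0 = 1" for y by (simp add: geom_nth)
  have "fps_nth (\<Prod>i\<in>J. geom (g i) ^ m i) 0 = 1" for J
    by (induction J rule: infinite_finite_induct) (auto simp: fps_power_zeroth gn)
  then have lead: "fps_nth F N = 1"
    unfolding F_def node_fps_def N_def[symmetric] by (simp add: fps_X_power_mult_nth)
  have s_sum: "summable (\<lambda>n. s n * (fps_nth F n * x ^ n))"
    and pair: "binomial_pairing (real k - 1/2) x F = (- 1) ^ k * suminf (\<lambda>n. s n * (fps_nth F n * x ^ n))"
  proof -
    note sm = summable_binomial_pairing[OF ev x, of k]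
    have e: "s n * (fps_nth F n * x ^ n)
      = (- 1) ^ k * ((- 1) ^ n * ((real k - 1/2) gchoose n) * (fps_nth F n * x ^ n))" for n
      by (simp add: s_def power_add)
    show "summable (\<lambda>n. s n * (fps_nth F n * x ^ n))"
      unfolding e by (rule summable_mult[OF sm])
    show "binomial_pairing (real k - 1/2) x F = (- 1) ^ k * suminf (\<lambda>n. s n * (fps_nth F n * x ^ n))"
      unfolding e suminf_mult[OF sm] binomial_pairing_def[symmetric]
      by (simp flip: mult.assoc power_add)
  qed
  have pos: "0 \<le> s n * (fps_nth F n * x ^ n)" for n
  proof (cases "n < N")
    case False
    then have "s n > 0" unfolding s_def using m by (intro gbinomial_half_integer_sign) (simp add: N_def)
    then show ?thesis using F0 x by simp
  qed (simp add: low)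
  have abs_pair: "\<bar>binomial_pairing (real k - 1/2) x F\<bar> = suminf (\<lambda>n. s n * (fps_nth F n * x ^ n))"
    unfolding pair using suminf_nonneg[OF s_sum pos] by (simp add: abs_mult power_abs)
  have "x ^ N / 4 ^ N \<le> s N * x ^ N"
  proof -
    have "s N > 0" unfolding s_def using m by (intro gbinomial_half_integer_sign) (simp add: N_def)
    moreover have "\<bar>s N\<bar> = \<bar>(real k - 1/2) gchoose N\<bar>" by (simp add: s_def abs_mult power_abs)
    ultimately have "1 / 4 ^ N \<le> s N" using gbinomial_half_integer_ge[of N k] by linarith
    then have "1 / 4 ^ N * x ^ N \<le> s N * x ^ N" using x by (intro mult_right_mono) auto
    then show ?thesis by simp
  qed
  also have "\<dots> = (\<Sum>n\<in>{N}. s n * (fps_nth F n * x ^ n))" by (simp add: lead)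
  also have "\<dots> \<le> suminf (\<lambda>n. s n * (fps_nth F n * x ^ n))"
    by (rule sum_le_suminf[OF s_sum]) (use pos in auto)
  finally show "x ^ ((\<Sum>i\<in>I. m i) - 1) / 4 ^ ((\<Sum>i\<in>I. m i) - 1)
      \<le> \<bar>binomial_pairing (real k - 1/2) x (node_fps I g m)\<bar>"
    using abs_pair unfolding F_def N_def by simp
  have "suminf (\<lambda>n. s n * (fps_nth F n * x ^ n)) \<le> suminf (\<lambda>n. 2 ^ k * (fps_nth F n * x ^ n))"
  proof (rule suminf_le[OF _ s_sum])
    show "summable (\<lambda>n. 2 ^ k * (fps_nth F n * x ^ n))" using Fv by (auto simp: sums_iff)
    show "s n * (fps_nth F n * x ^ n) \<le> 2 ^ k * (fps_nth F n * x ^ n)" for n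
    proof (rule mult_right_mono)
      have "s n \<le> \<bar>s n\<bar>" by simp
      also have "\<dots> \<le> 2 ^ k"
        using gbinomial_half_integer_le[of k n] by (simp add: s_def abs_mult power_abs)
      finally show "s n \<le> 2 ^ k" .
    qed (use F0 x in auto)
  qed
  also have "\<dots> = 2 ^ k * v" using Fv by (simp add: sums_iff suminf_mult)
  also have "\<dots> \<le> 2 ^ k * (x ^ N * 2 ^ (\<Sum>i\<in>I. m i))"
    unfolding v_def power_sum
  proof (intro mult_left_mono prod_mono conjI power_mono)
    fix i assume "i \<in> I"
    from g[OF this] show "1 / (1 - g i * x) \<le> 2" "0 \<le> 1 / (1 - g i * x)"
      by (auto simp: field_simps)
    then show "0 \<le> (1 / (1 - g i * x)) ^ m i" by simp
  qed (use x in auto)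
  finally show "\<bar>binomial_pairing (real k - 1/2) x (node_fps I g m)\<bar>
      \<le> 2 ^ k * (x ^ ((\<Sum>i\<in>I. m i) - 1) * 2 ^ (\<Sum>i\<in>I. m i))"
    using abs_pair unfolding F_def N_def by simp
qed


section \<open>The hypergeometric upper bound\<close>

text \<open>The divided difference gives a tiny nonzero form \<open>E\<close>. The integer
  \<open>Z\<close> differs from \<open>G * E\<close> by \<open>R\<close>. By \<open>low\<close>,
  \<open>R\<close> is smaller than \<open>G * E\<close>, so \<open>Z\<close> is nonzero; by
  \<open>high\<close>, \<open>G * E\<close> is below 1/2, so \<open>Z\<close> is smaller than 1 in
  absolute value.\<close>

lemma hermite_form_contradiction:
  fixes a b c e f A :: int
  assumes abc: "0 < a" "a < b" "b < c" "c \<le> A" and ef: "0 < e" "0 < f"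
    and sq: "\<And>u. u \<in> {a, b, c} \<Longrightarrow> sqrt (of_int (u * e + 1)) \<in> \<int> \<and> sqrt (of_int (u * f + 1)) \<in> \<int>"
    and low: "A ^ (39 * k + 38) * e ^ (3 * k + 2) < f"
    and high: "A ^ (46 * k + 52) * f < e ^ (4 * k + 3)"
  shows False
proof -
  let ?I = "{a, b, c}"
  \<comment> \<open>Here \<open>p u\<close> is \<open>a * b * c / u\<close>, and \<open>M\<close>
    and \<open>g\<close> are chosen so that \<open>M - g u = p u * (u * e + 1)\<close>. Thus the
    root of \<open>1 - g u / M\<close> contains \<open>sqrt (u * e + 1)\<close>.\<close>
  define p where "p = (\<lambda>u. if u = a then b * c else if u = b then a * c else a * b)"
  define M where "M = b * c * (a * e + 1)"
  define g where "g = (\<lambda>u. b * c - p u)"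
  \<comment> \<open>The Vandermonde product of the nodes, divisible by each of their
    differences.\<close>
  define D where "D = (g a - g b) * (g a - g c) * (g b - g c)"
  let ?N = "3 * Suc k"
  have A3: "3 \<le> A" and A1: "1 \<le> A" using abc by auto
  have pu: "u * p u = a * b * c" if "u \<in> ?I" for u using that by (auto simp: p_def)
  have bcA: "b * c \<le> A ^ 2" unfolding power2_eq_square using abc by (intro mult_mono) auto
  have p0: "0 < p u" and pbc: "p u \<le> b * c" if "u \<in> ?I" for u
    using that abc by (auto simp: p_def)
  have g0: "0 \<le> g u" "g u < b * c" if "u \<in> ?I" for u
    using p0[OF that] pbc[OF that] by (auto simp: g_def)
  have bc0: "0 < b * c" using abc by simp
  have ae: "2 \<le> a * e + 1" using abc ef by (smt (verit) mult_pos_pos)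
  \<comment> \<open>This provides \<open>g u / M \<le> 1/2\<close>, as
    \<open>binomial_pairing_bounds\<close> demands.\<close>
  have "b * c * 2 \<le> M" unfolding M_def using ae bc0 by (intro mult_left_mono) auto
  then have M2: "2 * (b * c) \<le> M" by simp
  then have M0: "0 < M" using bc0 by simp
  have eM: "e \<le> M"
  proof -
    have "1 \<le> b * c" using bc0 by linarith
    then have "1 * (1 * e) \<le> b * c * (a * e)" using abc ef by (intro mult_mono) auto
    then show ?thesis using bc0 unfolding M_def by (simp add: distrib_left)
  qed
  have ueA: "u * e + 1 \<le> A ^ 2 * e" if "u \<in> ?I" for u
  proof -
    have "u * e \<le> A * e" using that abc ef by (intro mult_right_mono) auto
    moreover have "1 \<le> A * e" using A1 ef by (smt (verit) mult_le_cancel_right1 mult_pos_pos)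
    moreover have "2 * (A * e) \<le> A * (A * e)" using A3 ef by (intro mult_right_mono) auto
    ultimately show ?thesis by (simp add: power2_eq_square mult.assoc)
  qed
  have MA: "M \<le> A ^ 4 * e"
  proof -
    have "M \<le> A ^ 2 * (A ^ 2 * e)" unfolding M_def using bcA ueA[of a] ae by (intro mult_mono) auto
    then show ?thesis by (simp add: power_numeral_reduce mult.assoc)
  qed
  have gdiff: "\<bar>g u - g v\<bar> \<le> A ^ 2" if "u \<in> ?I" "v \<in> ?I" for u v
    using g0[OF that(1)] g0[OF that(2)] bcA by linarith
  have D0: "D \<noteq> 0" using abc by (auto simp: D_def g_def p_def)
  have DA: "\<bar>D\<bar> \<le> A ^ 6"
  proof -
    have "\<bar>D\<bar> \<le> A ^ 2 * A ^ 2 * A ^ 2"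
      unfolding D_def abs_mult by (intro mult_mono gdiff) auto
    then show ?thesis by (simp flip: power_add)
  qed
  have Ddvd: "g u - g v dvd D" if "u \<in> ?I" "v \<in> ?I" "u \<noteq> v" for u v
  proof -
    have "g a - g b dvd D" "g a - g c dvd D" "g b - g c dvd D" unfolding D_def by simp_all
    moreover have "g w - g v dvd D" if "g v - g w dvd D" for v w
      using that by (metis minus_diff_eq minus_dvd_iff)
    ultimately show ?thesis using that by blast
  qed
  have card: "(\<Sum>u\<in>?I. Suc k) = ?N" using abc by simp
  define bp where "bp = binomial_pairing (real (Suc k) - 1/2) (1 / of_int M)
     (node_fps ?I (\<lambda>u. of_int (g u)) (\<lambda>_. Suc k))"
  define th where "th = (\<lambda>u. sqrt (1 - real_of_int (g u) / of_int M))"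
  have "\<exists>q :: int \<Rightarrow> int. (\<forall>u\<in>?I. \<bar>q u\<bar> \<le> (2 * \<bar>D\<bar>) ^ (\<Sum>u\<in>?I. Suc k) * (2 * (8 * M) ^ k)) \<and>
    of_int D ^ (\<Sum>u\<in>?I. Suc k) * ((4 * of_int M) ^ k * bp) = (\<Sum>u\<in>?I. of_int (q u) * th u)"
    unfolding bp_def th_def
  proof (rule binomial_pairing_linear_form)
    show "0 \<le> g u \<and> g u < M" if "u \<in> ?I" for u using g0[OF that] M2 bc0 by linarith
    show "(\<Sum>u\<in>?I. Suc k) \<noteq> 0" unfolding card by simp
    show "g u - g v dvd D" if "u \<in> ?I" "v \<in> ?I" "u \<noteq> v" for u v using that by (rule Ddvd)
    show "Suc k \<le> Suc k" by simp
    show "D \<noteq> 0" by (rule D0)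
    show "finite ?I" by simp
  qed
  then obtain q :: "int \<Rightarrow> int" where
    q': "\<forall>u\<in>?I. \<bar>q u\<bar> \<le> (2 * \<bar>D\<bar>) ^ ?N * (2 * (8 * M) ^ k)"
    and form: "of_int D ^ ?N * ((4 * of_int M) ^ k * bp) = (\<Sum>u\<in>?I. of_int (q u) * th u)"
    unfolding card by (elim exE conjE) (rule that)
  note q = bspec[OF q']
  define E where "E = (\<Sum>u\<in>?I. of_int (q u) * th u)"
  \<comment> \<open>Numerical constants are absorbed by \<open>A \<ge> 3\<close>, here and below.
    The exponent of \<open>A\<close> is \<open>21 * k + 21\<close> from the power of
    \<open>2 * \<bar>D\<bar>\<close> plus \<open>6 * k + 1\<close> from
    \<open>2 * (8 * M) ^ k\<close>.\<close>
  have qA: "\<bar>q u\<bar> \<le> A ^ (27 * k + 22) * e ^ k" if "u \<in> ?I" for u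
  proof -
    have "2 * \<bar>D\<bar> \<le> A * A ^ 6" using A3 DA by (intro mult_mono) auto
    then have 1: "(2 * \<bar>D\<bar>) ^ ?N \<le> (A * A ^ 6) ^ ?N" by (intro power_mono) auto
    have "8 * M \<le> A ^ 2 * (A ^ 4 * e)"
    proof (rule mult_mono)
      show "8 \<le> A ^ 2" using A3 power_mono[of 3 A 2] by simp
    qed (use MA M0 in auto)
    then have 2: "(8 * M) ^ k \<le> (A ^ 2 * (A ^ 4 * e)) ^ k" using M0 by (intro power_mono) auto
    have "\<bar>q u\<bar> \<le> (A * A ^ 6) ^ ?N * (A * (A ^ 2 * (A ^ 4 * e)) ^ k)"
      using 1 2 A3 M0 by (intro order_trans[OF q[OF that]] mult_mono) auto
    also have "\<dots> = A ^ (27 * k + 22) * e ^ k"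
    proof -
      have "27 * k + 22 = (21 + 21 * k) + (6 * k + 1)" by simp
      moreover have "(A * A ^ 6) ^ ?N = A ^ (21 + 21 * k)"
        by (simp flip: power_Suc power_mult)
      moreover have "A * (A ^ 2 * (A ^ 4 * e)) ^ k = A ^ (6 * k + 1) * e ^ k"
      proof -
        have "A ^ 2 * (A ^ 4 * e) = A ^ 6 * e" by (simp flip: mult.assoc power_add)
        then show ?thesis by (simp add: power_mult_distrib flip: power_mult)
      qed
      ultimately show ?thesis by (simp only: power_add mult_ac)
    qed
    finally show ?thesis .
  qed
  have x: "0 \<le> 1 / real_of_int M" using M0 by simp
  have gx: "0 \<le> real_of_int (g u) \<and> real_of_int (g u) * (1 / of_int M) \<le> 1/2" if "u \<in> ?I" for u
  proof -
    have "2 * g u \<le> M" using g0[OF that] M2 by linarith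
    then have "2 * real_of_int (g u) \<le> real_of_int M" by linarith
    then show ?thesis using g0[OF that] M0 by (simp add: field_simps)
  qed
  have n: "?N - 1 = 3 * k + 2" by simp
  have bp_low: "(1 / real_of_int M) ^ (3 * k + 2) / 4 ^ (3 * k + 2) \<le> \<bar>bp\<bar>"
    and bp_up: "\<bar>bp\<bar> \<le> 2 ^ Suc k * ((1 / real_of_int M) ^ (3 * k + 2) * 2 ^ (3 * k + 3))"
  proof -
    have kN: "Suc k \<le> 3 * k + 2" and N3: "?N = 3 * k + 3" by simp_all
    note bounds = binomial_pairing_bounds[where I = ?I and m = "\<lambda>_. Suc k" and k = "Suc k"
        and g = "\<lambda>u. of_int (g u)", OF x gx, unfolded card n, OF _ kN, folded bp_def, unfolded N3]
    show "(1 / real_of_int M) ^ (3 * k + 2) / 4 ^ (3 * k + 2) \<le> \<bar>bp\<bar>" by (rule bounds(1))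
    show "\<bar>bp\<bar> \<le> 2 ^ Suc k * ((1 / real_of_int M) ^ (3 * k + 2) * 2 ^ (3 * k + 3))"
      by (rule bounds(2))
  qed
  have Mr: "1 \<le> real_of_int M" "real_of_int e \<le> of_int M" "1 \<le> real_of_int A" "3 \<le> real_of_int A"
    "1 \<le> real_of_int e" "1 \<le> real_of_int f"
    using M0 eM A1 A3 ef by auto
  have absE: "\<bar>E\<bar> = of_int \<bar>D\<bar> ^ ?N * ((4 * of_int M) ^ k * \<bar>bp\<bar>)"
    using Mr unfolding E_def form[symmetric] by (simp add: abs_mult power_abs)
  \<comment> \<open>The factor \<open>(4 * M) ^ k\<close> cancels against
    \<open>(4 * M) ^ (3 * k + 2)\<close> in the denominator; of \<open>D\<close> only
    \<open>\<bar>D\<bar> \<ge> 1\<close> is kept.\<close>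
  have E_low: "1 / (of_int A ^ (12 * k + 12) * of_int e ^ (2 * k + 2)) \<le> \<bar>E\<bar>"
  proof -
    have "4 * M \<le> A ^ 2 * (A ^ 4 * e)"
    proof (rule mult_mono)
      show "4 \<le> A ^ 2" using A3 power_mono[of 3 A 2] by simp
    qed (use MA M0 in auto)
    also have "\<dots> = A ^ 6 * e" by (simp flip: mult.assoc power_add)
    finally have "4 * real_of_int M \<le> of_int A ^ 6 * of_int e"
      by (metis of_int_le_iff of_int_mult of_int_numeral of_int_power)
    then have "(4 * real_of_int M) ^ (2 * k + 2) \<le> (of_int A ^ 6 * of_int e) ^ (2 * k + 2)"
      using Mr by (intro power_mono) auto
    also have "\<dots> = of_int A ^ (12 * k + 12) * of_int e ^ (2 * k + 2)"
    proof -
      have "6 * (2 * k + 2) = 12 * k + 12" by simp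
      then show ?thesis by (simp only: power_mult_distrib flip: power_mult)
    qed
    finally have "1 / (of_int A ^ (12 * k + 12) * of_int e ^ (2 * k + 2))
        \<le> 1 / (4 * real_of_int M) ^ (2 * k + 2)"
      using Mr by (intro divide_left_mono) auto
    also have "\<dots> = 1 * ((4 * of_int M) ^ k * ((1 / real_of_int M) ^ (3 * k + 2) / 4 ^ (3 * k + 2)))"
    proof -
      have "3 * k + 2 = k + (2 * k + 2)" by simp
      then have "(4 * real_of_int M) ^ (3 * k + 2) = (4 * real_of_int M) ^ k * (4 * real_of_int M) ^ (2 * k + 2)"
        by (simp only: power_add)
      moreover have "(1 / real_of_int M) ^ (3 * k + 2) / 4 ^ (3 * k + 2) = 1 / (4 * real_of_int M) ^ (3 * k + 2)"
        by (simp add: power_mult_distrib power_one_over field_simps)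
      ultimately show ?thesis using Mr by simp
    qed
    also have "\<dots> \<le> \<bar>E\<bar>"
      unfolding absE
    proof (intro mult_mono mult_left_mono bp_low)
      show "1 \<le> real_of_int \<bar>D\<bar> ^ ?N" using D0 by (intro one_le_power) linarith
    qed (use Mr in auto)
    finally show ?thesis .
  qed
  \<comment> \<open>Now \<open>M\<close> is left in the denominator, where \<open>e \<le> M\<close>
    applies. The exponent of \<open>A\<close> is \<open>18 * k + 18\<close> from \<open>D\<close>,
    \<open>2 * k\<close> from \<open>4 ^ k\<close> and \<open>3 * k + 3\<close> from
    \<open>16 ^ (k + 1)\<close>.\<close>
  have E_up: "\<bar>E\<bar> \<le> of_int A ^ (23 * k + 21) / of_int e ^ (2 * k + 2)"
  proof -
    have "real_of_int \<bar>D\<bar> \<le> of_int A ^ 6" using DA by (metis of_int_le_iff of_int_power)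
    then have 1: "real_of_int \<bar>D\<bar> ^ ?N \<le> (of_int A ^ 6) ^ ?N" by (intro power_mono) auto
    have "(4 * real_of_int M) ^ k * \<bar>bp\<bar>
      \<le> (4 * real_of_int M) ^ k * (2 ^ Suc k * ((1 / real_of_int M) ^ (3 * k + 2) * 2 ^ (3 * k + 3)))"
      using Mr by (intro mult_left_mono bp_up) auto
    also have "\<dots> = 4 ^ k * 16 ^ (k + 1) / of_int M ^ (2 * k + 2)"
    proof -
      have "(16::real) ^ (k + 1) = 2 ^ (4 * (k + 1))" by (simp only: power_mult) simp
      also have "4 * (k + 1) = Suc k + (3 * k + 3)" by simp
      finally have "(16::real) ^ (k + 1) = 2 ^ Suc k * 2 ^ (3 * k + 3)" by (simp only: power_add)
      moreover have "3 * k + 2 = k + (2 * k + 2)" by simp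
      then have "real_of_int M ^ (3 * k + 2) = of_int M ^ k * of_int M ^ (2 * k + 2)"
        by (simp only: power_add)
      then have "(1 / real_of_int M) ^ (3 * k + 2) = 1 / (of_int M ^ k * of_int M ^ (2 * k + 2))"
        by (simp only: power_one_over power_divide power_one)
      ultimately show ?thesis using Mr by (simp add: power_mult_distrib)
    qed
    also have "\<dots> \<le> (of_int A ^ 2) ^ k * (of_int A ^ 3) ^ (k + 1) / of_int e ^ (2 * k + 2)"
    proof (intro frac_le mult_mono power_mono)
      show "(4::real) \<le> of_int A ^ 2" using power_mono[OF Mr(4), of 2] by simp
      show "(16::real) \<le> of_int A ^ 3" using power_mono[OF Mr(4), of 3] by simp
    qed (use Mr in auto)
    finally have "\<bar>E\<bar> \<le> (of_int A ^ 6) ^ ?N * ((of_int A ^ 2) ^ k * (of_int A ^ 3) ^ (k + 1) / of_int e ^ (2 * k + 2))"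
      unfolding absE using 1 Mr by (intro mult_mono) auto
    also have "\<dots> = of_int A ^ (23 * k + 21) / of_int e ^ (2 * k + 2)"
    proof -
      have "6 * ?N + (2 * k + 3 * (k + 1)) = 23 * k + 21" by simp
      then show ?thesis by (simp only: times_divide_eq_right flip: power_mult power_add)
    qed
    finally show ?thesis .
  qed
  define Xe where "Xe = (\<lambda>u. sqrt (of_int (u * e + 1)))"
  define Yf where "Yf = (\<lambda>u. sqrt (of_int (u * f + 1)))"
  \<comment> \<open>\<open>G\<close> is the factor that turns \<open>th u\<close> into
    \<open>p u * Xe u * sqrt (u * f)\<close>; \<open>R\<close> is the error of writing
    \<open>sqrt (u * f)\<close> for \<open>Yf u\<close>, which makes the sum the integer
    \<open>Z\<close>.\<close>
  define Z where "Z = (\<Sum>u\<in>?I. of_int (p u * q u) * Xe u * Yf u)"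
  define G where "G = sqrt (of_int (M * (a * b * c) * f))"
  define R where "R = (\<Sum>u\<in>?I. of_int (p u * q u) * Xe u * (Yf u - sqrt (of_int (u * f))))"
  have th: "th u = sqrt (of_int (p u)) * Xe u / sqrt (of_int M)" if "u \<in> ?I" for u
  proof -
    have "M - g u = p u * (u * e + 1)"
      using pu[OF that] unfolding M_def g_def by (simp add: algebra_simps)
    then have "real_of_int M - of_int (g u) = of_int (p u) * of_int (u * e + 1)"
      by (metis of_int_diff of_int_mult)
    then have "1 - real_of_int (g u) / of_int M = of_int (p u) * of_int (u * e + 1) / of_int M"
      using Mr by (simp add: field_simps)
    then show ?thesis by (simp add: th_def Xe_def real_sqrt_mult real_sqrt_divide)
  qed
  have main: "of_int (p u * q u) * Xe u * sqrt (of_int (u * f)) = G * (of_int (q u) * th u)" if "u \<in> ?I" for u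
  proof -
    have "G = sqrt (of_int M) * sqrt (of_int (u * f)) * sqrt (of_int (p u))"
      unfolding G_def pu[OF that, symmetric] by (simp add: real_sqrt_mult mult_ac)
    then have "G * th u = sqrt (of_int (u * f)) * Xe u * (sqrt (of_int (p u)) * sqrt (of_int (p u)))"
      unfolding th[OF that] using Mr by simp
    also have "\<dots> = sqrt (of_int (u * f)) * Xe u * of_int (p u)" using p0[OF that] by simp
    finally show ?thesis by (simp add: mult_ac)
  qed
  have Z: "Z = G * E + R"
  proof -
    have "Z - R = (\<Sum>u\<in>?I. of_int (p u * q u) * Xe u * sqrt (of_int (u * f)))"
      unfolding Z_def R_def by (simp only: right_diff_distrib flip: sum_subtractf) simp
    also have "\<dots> = G * E"
      unfolding E_def sum_distrib_left by (intro sum.cong main refl)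
    finally show ?thesis by simp
  qed
  have "Z \<in> \<int>" using sq unfolding Z_def Xe_def Yf_def by (intro Ints_sum Ints_mult Ints_of_int) blast+
  define h where "h = sqrt (of_int (e * f))"
  have h: "h = sqrt (of_int e) * sqrt (of_int f)" unfolding h_def by (simp add: real_sqrt_mult)
  have sqrt_sq_mult: "sqrt ((of_int A ^ i) ^ 2 * y) = of_int A ^ i * sqrt y" for i and y :: real
    using Mr by (simp only: real_sqrt_mult real_sqrt_abs) simp
  have h0: "0 < h" unfolding h_def using ef by simp
  have hf: "sqrt (of_int e) / sqrt (of_int f) = h / of_int f"
    unfolding h using Mr by (simp add: field_simps)
  have G_low: "h \<le> G"
  proof -
    have "0 < a * b * c" using abc by simp
    then have "e * 1 * f \<le> M * (a * b * c) * f" using eM M0 ef by (intro mult_mono) auto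
    then have "real_of_int (e * f) \<le> of_int (M * (a * b * c) * f)" by (simp only: of_int_le_iff mult_1_right)
    then show ?thesis unfolding h_def G_def by (rule real_sqrt_le_mono)
  qed
  have G_up: "G \<le> of_int A ^ 4 * h"
  proof -
    have "a * b * c \<le> A * A * A" using abc by (intro mult_mono) auto
    also have "\<dots> \<le> A ^ 4" using A1 by (simp add: power_numeral_reduce)
    finally have "M * (a * b * c) * f \<le> (A ^ 4 * e) * A ^ 4 * f"
      using MA M0 ef abc A1 by (intro mult_mono) auto
    also have "\<dots> = (A ^ 4) ^ 2 * (e * f)" by (simp add: power2_eq_square mult_ac)
    finally have "real_of_int (M * (a * b * c) * f) \<le> (of_int A ^ 4) ^ 2 * of_int (e * f)"
      by (metis of_int_le_iff of_int_mult of_int_power)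
    then have "G \<le> sqrt ((of_int A ^ 4) ^ 2 * of_int (e * f))"
      unfolding G_def by (rule real_sqrt_le_mono)
    then show ?thesis unfolding h_def sqrt_sq_mult .
  qed
  have R_up: "\<bar>R\<bar> \<le> of_int A ^ (27 * k + 26) * of_int e ^ k * h / of_int f"
  proof -
    have t: "\<bar>of_int (p u * q u) * Xe u * (Yf u - sqrt (of_int (u * f)))\<bar>
        \<le> of_int A ^ 2 * (of_int A ^ (27 * k + 22) * of_int e ^ k) * (of_int A * sqrt (of_int e)) * (1 / sqrt (of_int f))"
      if u: "u \<in> ?I" for u
    proof -
      have u1: "1 \<le> real_of_int u" using u abc by auto
      have "\<bar>real_of_int (p u)\<bar> \<le> of_int A ^ 2"
      proof -
        have "\<bar>p u\<bar> \<le> A ^ 2" using p0[OF u] pbc[OF u] bcA by linarith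
        then show ?thesis by (simp only: of_int_le_iff flip: of_int_power of_int_abs)
      qed
      moreover have "\<bar>real_of_int (q u)\<bar> \<le> of_int A ^ (27 * k + 22) * of_int e ^ k"
        using qA[OF u] by (simp only: of_int_le_iff flip: of_int_power of_int_abs of_int_mult)
      moreover have "\<bar>Xe u\<bar> \<le> of_int A * sqrt (of_int e)"
      proof -
        have "real_of_int (u * e + 1) \<le> of_int A ^ 2 * of_int e"
          using ueA[OF u] by (metis of_int_le_iff of_int_mult of_int_power)
        then have "Xe u \<le> sqrt (of_int A ^ 2 * of_int e)" unfolding Xe_def by (rule real_sqrt_le_mono)
        moreover have "0 \<le> Xe u" unfolding Xe_def using u abc ef by auto
        ultimately show ?thesis using Mr by (simp add: real_sqrt_mult)
      qed
      \<comment> \<open>Rationalizing: the difference equals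
        \<open>1 / (Yf u + sqrt (u * f))\<close>.\<close>
      moreover have "\<bar>Yf u - sqrt (of_int (u * f))\<bar> \<le> 1 / sqrt (of_int f)"
      proof -
        let ?s = "sqrt (real_of_int (u * f))"
        have uf: "real_of_int f \<le> real_of_int (u * f)" using u1 Mr by simp
        have s: "sqrt (of_int f) \<le> ?s" using uf by simp
        have s0: "0 < sqrt (real_of_int f)" using Mr by simp
        have sY: "?s \<le> Yf u" unfolding Yf_def by simp
        have "(Yf u - ?s) * (Yf u + ?s) = Yf u ^ 2 - ?s ^ 2" by (simp add: power2_eq_square algebra_simps)
        also have "\<dots> = 1" unfolding Yf_def using uf Mr by simp
        finally have "(Yf u - ?s) * (Yf u + ?s) = 1" .
        moreover have "sqrt (of_int f) \<le> Yf u + ?s" "0 \<le> Yf u - ?s" using s sY s0 by linarith+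
        then have "(Yf u - ?s) * sqrt (of_int f) \<le> (Yf u - ?s) * (Yf u + ?s)" by (rule mult_left_mono)
        ultimately have "(Yf u - ?s) * sqrt (of_int f) \<le> 1" by simp
        then have "Yf u - ?s \<le> 1 / sqrt (of_int f)" using s0 by (simp add: pos_le_divide_eq)
        then show ?thesis using sY by simp
      qed
      ultimately show ?thesis unfolding abs_mult of_int_mult
        using Mr by (intro mult_mono) auto
    qed
    have "\<bar>R\<bar> \<le> (\<Sum>u\<in>?I. \<bar>of_int (p u * q u) * Xe u * (Yf u - sqrt (of_int (u * f)))\<bar>)"
      unfolding R_def by (rule sum_abs)
    also have "\<dots> \<le> of_nat (card ?I) * (of_int A ^ 2 * (of_int A ^ (27 * k + 22) * of_int e ^ k)
        * (of_int A * sqrt (of_int e)) * (1 / sqrt (of_int f)))"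
      by (rule sum_bounded_above) (rule t)
    also have "\<dots> \<le> of_int A * (of_int A ^ 2 * (of_int A ^ (27 * k + 22) * of_int e ^ k)
        * (of_int A * sqrt (of_int e)) * (1 / sqrt (of_int f)))"
      using Mr abc by (intro mult_right_mono) auto
    also have "\<dots> = (of_int A * of_int A ^ 2 * of_int A ^ (27 * k + 22) * of_int A) * of_int e ^ k
        * (sqrt (of_int e) / sqrt (of_int f))"
      by simp
    also have "real_of_int A * of_int A ^ 2 * of_int A ^ (27 * k + 22) * of_int A = of_int A ^ (27 * k + 26)"
    proof -
      have "27 * k + 26 = 1 + 2 + (27 * k + 22) + 1" by simp
      then show ?thesis by (simp only: power_add power_one_right)
    qed
    finally show ?thesis unfolding hf by simp
  qed
  have GE_low: "h / (of_int A ^ (12 * k + 12) * of_int e ^ (2 * k + 2)) \<le> \<bar>G * E\<bar>"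
  proof -
    have "h * (1 / (of_int A ^ (12 * k + 12) * of_int e ^ (2 * k + 2))) \<le> \<bar>G\<bar> * \<bar>E\<bar>"
      using G_low h0 E_low Mr by (intro mult_mono) auto
    then show ?thesis by (simp add: abs_mult)
  qed
  have R_GE: "\<bar>R\<bar> < \<bar>G * E\<bar>"
  proof -
    have "39 * k + 38 = (27 * k + 26) + (12 * k + 12)" "3 * k + 2 = k + (2 * k + 2)" by simp_all
    then have "A ^ (39 * k + 38) = A ^ (27 * k + 26) * A ^ (12 * k + 12)"
      "e ^ (3 * k + 2) = e ^ k * e ^ (2 * k + 2)"
      by (simp_all only: power_add)
    then have "(A ^ (27 * k + 26) * e ^ k) * (A ^ (12 * k + 12) * e ^ (2 * k + 2)) < f"
      using low by (simp only: mult_ac)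
    then have "(of_int A ^ (27 * k + 26) * of_int e ^ k)
        * (of_int A ^ (12 * k + 12) * of_int e ^ (2 * k + 2)) < real_of_int f"
      by (simp only: of_int_less_iff flip: of_int_mult of_int_power)
    then have "of_int A ^ (27 * k + 26) * of_int e ^ k / real_of_int f
        < 1 / (of_int A ^ (12 * k + 12) * of_int e ^ (2 * k + 2))"
      using Mr by (simp add: divide_less_eq less_divide_eq mult_ac)
    from mult_strict_left_mono[OF this h0] show ?thesis using R_up GE_low by (simp add: mult_ac)
  qed
  \<comment> \<open>Multiplying \<open>high\<close> by \<open>e\<close> makes \<open>e * f\<close>
    appear beside perfect squares, so a root can be taken. In \<open>23 * k + 26\<close> the part
    \<open>23 * k + 21\<close> comes from \<open>E\<close>, 4 from \<open>G\<close> and 1 from the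
    factor 2.\<close>
  have GE_up: "\<bar>G * E\<bar> < 1/2"
  proof -
    have "A ^ (46 * k + 52) * f * e < e ^ (4 * k + 3) * e" using high ef by (intro mult_strict_right_mono) auto
    moreover have "A ^ (46 * k + 52) * f * e = (A ^ (23 * k + 26)) ^ 2 * (e * f)"
    proof -
      have "46 * k + 52 = (23 * k + 26) * 2" by simp
      then have "A ^ (46 * k + 52) = (A ^ (23 * k + 26)) ^ 2" by (simp only: power_mult)
      then show ?thesis by (simp only: mult_ac)
    qed
    moreover have "e ^ (4 * k + 3) * e = (e ^ (2 * k + 2)) ^ 2"
    proof -
      have "(2 * k + 2) * 2 = (4 * k + 3) + 1" by simp
      then have "e ^ ((2 * k + 2) * 2) = e ^ (4 * k + 3) * e" by (simp only: power_add power_one_right)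
      then show ?thesis by (simp only: power_mult)
    qed
    ultimately have "(A ^ (23 * k + 26)) ^ 2 * (e * f) < (e ^ (2 * k + 2)) ^ 2" by simp
    then have "(of_int A ^ (23 * k + 26)) ^ 2 * real_of_int (e * f) < (of_int e ^ (2 * k + 2)) ^ 2"
      by (metis of_int_less_iff of_int_mult of_int_power)
    then have "sqrt ((of_int A ^ (23 * k + 26)) ^ 2 * real_of_int (e * f)) < sqrt ((of_int e ^ (2 * k + 2)) ^ 2)"
      by (rule real_sqrt_less_mono)
    then have key: "of_int A ^ (23 * k + 26) * h < of_int e ^ (2 * k + 2)"
      using Mr unfolding h_def sqrt_sq_mult real_sqrt_abs by simp
    have "2 * \<bar>G * E\<bar> \<le> of_int A * ((of_int A ^ 4 * h) * (of_int A ^ (23 * k + 21) / of_int e ^ (2 * k + 2)))"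
      unfolding abs_mult using Mr G_up G_low h0 E_up by (intro mult_mono) auto
    also have "\<dots> = of_int A ^ (23 * k + 26) * h / of_int e ^ (2 * k + 2)"
    proof -
      have "23 * k + 26 = 1 + 4 + (23 * k + 21)" by simp
      then have "real_of_int A ^ (23 * k + 26) = of_int A * of_int A ^ 4 * of_int A ^ (23 * k + 21)"
        by (simp only: power_add power_one_right)
      then show ?thesis by simp
    qed
    also have "\<dots> < 1" using key Mr by simp
    finally show ?thesis by simp
  qed
  have "0 < \<bar>Z\<bar>" "\<bar>Z\<bar> < 1" unfolding Z using R_GE GE_up by linarith+
  then show False using Ints_nonzero_abs_less1[OF \<open>Z \<in> \<int>\<close>] by auto
qed

text \<open>For \<open>k = 2 * j\<close> the forbidden window runs, up to powers of
  \<open>c\<close>, from \<open>e ^ (6 * j + 2)\<close> to \<open>e ^ (8 * j + 3)\<close> and covers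
  the block from \<open>e ^ (7 * j)\<close> to \<open>e ^ (7 * j + 7)\<close>. The margins
  \<open>e ^ (j - 2)\<close> and \<open>e ^ (j - 4)\<close> beat the powers of \<open>c\<close> for
  \<open>j \<ge> 6\<close>, and \<open>42 = 7 * 6\<close>.\<close>

lemma extension_upper_bound:
  fixes a b c e f :: int
  assumes abc: "0 < a" "a < b" "b < c" and e: "c ^ 400 \<le> e" and f: "0 < f"
    and sq: "\<And>u. u \<in> {a, b, c} \<Longrightarrow> sqrt (of_int (u * e + 1)) \<in> \<int> \<and> sqrt (of_int (u * f + 1)) \<in> \<int>"
  shows "f < e ^ 42"
proof (rule ccontr)
  assume "\<not> f < e ^ 42"
  then have f42: "e ^ 42 \<le> f" by simp
  have c: "3 \<le> c" using abc by simp
  then have "c ^ 1 \<le> c ^ 400" by (intro power_increasing) auto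
  then have e3: "3 \<le> e" using e c by simp
  have e7: "2 \<le> nat (e ^ 7)" using e3 self_le_power[of e 7] by (simp add: nat_le_iff le_nat_iff)
  have "1 \<le> nat f" using f by simp
  from ex_power_ivl1[OF e7 this] obtain j where
    "nat (e ^ 7) ^ j \<le> nat f" "nat f < nat (e ^ 7) ^ (j + 1)" by blast
  then have j: "e ^ (7 * j) \<le> f" "f < e ^ (7 + 7 * j)"
    using e3 f by (auto simp: nat_power_eq[symmetric] nat_less_iff le_nat_iff nat_le_eq_zle
      simp flip: power_mult power_add)
  have "e ^ 42 < e ^ (7 + 7 * j)" using f42 j(2) by simp
  then have "42 < 7 + 7 * j" using e3 by (subst (asm) power_strict_increasing_iff) auto
  then have j6: "6 \<le> j" by simp
  have ce: "c ^ (400 * i) \<le> e ^ i" for i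
    using power_mono[OF e, of i] c by (simp add: power_mult)
  show False
  proof (rule hermite_form_contradiction[OF abc order_refl _ f sq, where k = "2 * j"])
    have "c ^ (39 * (2 * j) + 38) < c ^ (400 * (j - 2))"
      using c j6 by (intro power_strict_increasing) auto
    also have "\<dots> \<le> e ^ (j - 2)" by (rule ce)
    finally have "c ^ (39 * (2 * j) + 38) * e ^ (3 * (2 * j) + 2) < e ^ (j - 2) * e ^ (3 * (2 * j) + 2)"
      using e3 by (intro mult_strict_right_mono) auto
    also have "\<dots> = e ^ (7 * j)"
    proof -
      have "j - 2 + (3 * (2 * j) + 2) = 7 * j" using j6 by simp
      then show ?thesis by (simp only: flip: power_add)
    qed
    finally show "c ^ (39 * (2 * j) + 38) * e ^ (3 * (2 * j) + 2) < f" using j(1) by simp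
    \<comment> \<open>The tightest condition: \<open>92 * j + 52 \<le> 400 * (j - 4)\<close> holds
      from \<open>j = 6\<close> on and fails for \<open>j = 5\<close>.\<close>
    have "c ^ (46 * (2 * j) + 52) \<le> c ^ (400 * (j - 4))"
      using c j6 by (intro power_increasing) auto
    also have "\<dots> \<le> e ^ (j - 4)" by (rule ce)
    finally have "c ^ (46 * (2 * j) + 52) * f \<le> e ^ (j - 4) * f" using f by (intro mult_right_mono) auto
    also have "\<dots> < e ^ (j - 4) * e ^ (7 + 7 * j)" using j(2) e3 by (intro mult_strict_left_mono) auto
    also have "\<dots> = e ^ (4 * (2 * j) + 3)"
    proof -
      have "j - 4 + (7 + 7 * j) = 4 * (2 * j) + 3" using j6 by simp
      then show ?thesis by (simp only: flip: power_add)
    qed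
    finally show "c ^ (46 * (2 * j) + 52) * f < e ^ (4 * (2 * j) + 3)" .
  qed (use e3 in auto)
qed


section \<open>The gap principle\<close>

definition det3 :: "real \<times> real \<times> real \<Rightarrow> real \<times> real \<times> real \<Rightarrow> real \<times> real \<times> real \<Rightarrow> real" where
  "det3 = (\<lambda>(x1, y1, z1) (x2, y2, z2) (x3, y3, z3).
     x1 * (y2 * z3 - z2 * y3) - x2 * (y1 * z3 - z1 * y3) + x3 * (y1 * z2 - z1 * y2))"

definition sqrt_vector :: "real \<Rightarrow> real \<Rightarrow> real \<Rightarrow> real \<Rightarrow> real \<times> real \<times> real" where
  "sqrt_vector a b c w = (sqrt (a * w + 1), sqrt (b * w + 1), sqrt (c * w + 1))"

text \<open>For isotropic vectors the Gram matrix has a zero diagonal, hence the product on the right.\<close>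

lemma gram_det3:
  fixes q1 q2 q3 :: real
  assumes "q1 * x1 * x1 + q2 * y1 * y1 + q3 * z1 * z1 = 0"
    and "q1 * x2 * x2 + q2 * y2 * y2 + q3 * z2 * z2 = 0"
    and "q1 * x3 * x3 + q2 * y3 * y3 + q3 * z3 * z3 = 0"
  shows "q1 * q2 * q3 * det3 (x1, y1, z1) (x2, y2, z2) (x3, y3, z3) ^ 2
    = 2 * (q1 * x1 * x2 + q2 * y1 * y2 + q3 * z1 * z2) * (q1 * x2 * x3 + q2 * y2 * y3 + q3 * z2 * z3)
        * (q1 * x1 * x3 + q2 * y1 * y3 + q3 * z1 * z3)"
proof -
  let ?B = "\<lambda>x y z x' y' z'. q1 * x * x' + q2 * y * y' + q3 * z * z'"
  have "q1 * q2 * q3 * det3 (x1, y1, z1) (x2, y2, z2) (x3, y3, z3) ^ 2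
    = ?B x1 y1 z1 x1 y1 z1 * ?B x2 y2 z2 x2 y2 z2 * ?B x3 y3 z3 x3 y3 z3
      - ?B x1 y1 z1 x1 y1 z1 * ?B x2 y2 z2 x3 y3 z3 ^ 2
      - ?B x2 y2 z2 x2 y2 z2 * ?B x1 y1 z1 x3 y3 z3 ^ 2
      - ?B x3 y3 z3 x3 y3 z3 * ?B x1 y1 z1 x2 y2 z2 ^ 2
      + 2 * ?B x1 y1 z1 x2 y2 z2 * ?B x2 y2 z2 x3 y3 z3 * ?B x1 y1 z1 x3 y3 z3"
    unfolding det3_def by (simp add: power2_eq_square algebra_simps)
  then show ?thesis unfolding assms by simp
qed

text \<open>Vanishing would be the equality case of Cauchy-Schwarz, as the middle coordinate squared is a
  convex combination of the squares of the outer ones.\<close>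

lemma sqrt_vector_form_nonzero:
  assumes abc: "0 < a" "a < b" "b < c" and w: "0 < v" "0 < w" "v \<noteq> w"
  shows "(b - c) * sqrt (a * v + 1) * sqrt (a * w + 1) + (c - a) * sqrt (b * v + 1) * sqrt (b * w + 1)
    + (a - b) * sqrt (c * v + 1) * sqrt (c * w + 1) \<noteq> 0"
proof
  let ?x = "sqrt (a * v + 1)" and ?y = "sqrt (b * v + 1)" and ?z = "sqrt (c * v + 1)"
  let ?x' = "sqrt (a * w + 1)" and ?y' = "sqrt (b * w + 1)" and ?z' = "sqrt (c * w + 1)"
  have sq: "?x ^ 2 = a * v + 1" "?y ^ 2 = b * v + 1" "?z ^ 2 = c * v + 1"
    "?x' ^ 2 = a * w + 1" "?y' ^ 2 = b * w + 1" "?z' ^ 2 = c * w + 1"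
    using assms by auto
  assume "(b - c) * ?x * ?x' + (c - a) * ?y * ?y' + (a - b) * ?z * ?z' = 0"
  then have "(c - a) * (?y * ?y') = (c - b) * (?x * ?x') + (b - a) * (?z * ?z')"
    by (simp add: algebra_simps)
  from arg_cong[OF this, of "\<lambda>t. t ^ 2"]
  have "(c - a) ^ 2 * (?y ^ 2 * ?y' ^ 2) = (c - b) ^ 2 * (?x ^ 2 * ?x' ^ 2) + (b - a) ^ 2 * (?z ^ 2 * ?z' ^ 2)
      + 2 * ((c - b) * (b - a)) * (?x * ?z' * (?x' * ?z))"
    by (simp add: power_mult_distrib power2_sum mult_ac)
  moreover have "(c - a) ^ 2 * (?y ^ 2 * ?y' ^ 2) = (c - b) ^ 2 * (?x ^ 2 * ?x' ^ 2)
      + (b - a) ^ 2 * (?z ^ 2 * ?z' ^ 2) + (c - b) * (b - a) * (?x ^ 2 * ?z' ^ 2 + ?x' ^ 2 * ?z ^ 2)"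
    unfolding sq by (simp add: power2_eq_square algebra_simps)
  \<comment> \<open>Subtracting the two expansions leaves a square with a positive
    coefficient.\<close>
  ultimately have "(c - b) * (b - a) * (?x * ?z' - ?x' * ?z) ^ 2 = 0"
    by (simp add: power2_diff power_mult_distrib algebra_simps)
  then have "?x * ?z' = ?x' * ?z" using abc by simp
  from arg_cong[OF this, of "\<lambda>t. t ^ 2"] have "?x ^ 2 * ?z' ^ 2 = ?x' ^ 2 * ?z ^ 2"
    by (simp add: power_mult_distrib)
  then have "(a * v + 1) * (c * w + 1) = (a * w + 1) * (c * v + 1)" unfolding sq .
  then have "(c - a) * (w - v) = 0" by (simp add: algebra_simps)
  then show False using abc w by simp
qed

text \<open>The vectors are isotropic for the diagonal form with entries \<open>b - c\<close>,
  \<open>c - a\<close>, \<open>a - b\<close>. By \<open>gram_det3\<close> the squared determinant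
  is, up to nonzero factors, the product of their mutual pairings, none of which vanishes.\<close>

lemma det3_sqrt_vector_nonzero:
  assumes abc: "0 < a" "a < b" "b < c" and w: "0 < d" "d < e" "e < f"
  shows "det3 (sqrt_vector a b c d) (sqrt_vector a b c e) (sqrt_vector a b c f) \<noteq> 0"
proof
  assume z: "det3 (sqrt_vector a b c d) (sqrt_vector a b c e) (sqrt_vector a b c f) = 0"
  have iso: "(b - c) * sqrt (a * v + 1) * sqrt (a * v + 1) + (c - a) * sqrt (b * v + 1) * sqrt (b * v + 1)
    + (a - b) * sqrt (c * v + 1) * sqrt (c * v + 1) = 0" if "0 < v" for v
    using that abc by (simp add: mult.assoc) (simp add: algebra_simps)
  have "0 < e" "0 < f" using w by auto
  from gram_det3[OF iso[OF w(1)] iso[OF this(1)] iso[OF this(2)]] z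
    sqrt_vector_form_nonzero[OF abc, of d e] sqrt_vector_form_nonzero[OF abc, of e f]
    sqrt_vector_form_nonzero[OF abc, of d f]
  show False using w unfolding sqrt_vector_def by auto
qed

text \<open>Expansion along the first column after column operations: an entry is at most
  \<open>sqrt (2 * a * f)\<close> and a minor at most
  \<open>sqrt (b * c) / (2 * a * sqrt (d * e))\<close>. Each of the three terms is thus at most
  \<open>K\<close>, and \<open>(3 * K) ^ 2\<close> produces the constants.\<close>

lemma det3_sqrt_vector_le:
  fixes a b c d e f :: real
  assumes abc: "1 \<le> a" "a < b" "b < c" and w: "1 \<le> d" "d < e" "e < f"
  shows "2 * a ^ 3 * d * e * det3 (sqrt_vector a b c d) (sqrt_vector a b c e) (sqrt_vector a b c f) ^ 2
    \<le> 9 * b * c * f"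
proof -
  define x where "x = (\<lambda>v. sqrt (a * v + 1))"
  \<comment> \<open>Subtracting multiples of the first column leaves small entries, since all rows are close to
    the direction \<open>(sqrt a, sqrt b, sqrt c)\<close>.\<close>
  define eta where "eta = (\<lambda>u v. sqrt a * sqrt (u * v + 1) - sqrt u * sqrt (a * v + 1))"
  \<comment> \<open>Rationalizing: \<open>?q - ?p = (u - a) / (?q + ?p)\<close>, where both
    \<open>?p\<close> and \<open>?q\<close> are at least \<open>sqrt (a * u * v)\<close>.\<close>
  have eta: "\<bar>eta u v\<bar> \<le> sqrt u / (2 * sqrt a * sqrt v)" if "a < u" "1 \<le> v" for u v
  proof -
    let ?p = "sqrt a * sqrt (u * v + 1)" and ?q = "sqrt u * sqrt (a * v + 1)"
    have u: "0 < u" and uv: "0 < u * v" and av: "0 < a * v" using that abc by auto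
    have "sqrt (a * (u * v)) \<le> sqrt (a * (u * v + 1))" "sqrt (u * (a * v)) \<le> sqrt (u * (a * v + 1))"
      using abc u by (auto simp: algebra_simps)
    then have pq: "sqrt a * sqrt u * sqrt v \<le> ?p" "sqrt a * sqrt u * sqrt v \<le> ?q"
      by (simp_all add: real_sqrt_mult mult_ac)
    have s0: "0 < sqrt a * sqrt u * sqrt v" using abc u that by simp
    have "(?q - ?p) * (?q + ?p) = ?q ^ 2 - ?p ^ 2" by (simp add: power2_eq_square algebra_simps)
    also have "\<dots> = u * (a * v + 1) - a * (u * v + 1)"
      using abc u uv av by (simp add: power_mult_distrib)
    also have "\<dots> = u - a" by (simp add: algebra_simps)
    finally have e: "(?q - ?p) * (?q + ?p) = u - a" .
    have pqs: "0 < ?q + ?p" using pq s0 by linarith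
    have qp: "0 \<le> ?q - ?p"
      using e pqs that by (metis diff_ge_0_iff_ge less_imp_le zero_le_mult_iff not_less)
    have "(?q - ?p) * (2 * (sqrt a * sqrt u * sqrt v)) \<le> (?q - ?p) * (?q + ?p)"
      using pq qp by (intro mult_left_mono) auto
    also have "\<dots> \<le> sqrt u * sqrt u" unfolding e using abc u by simp
    finally have "((?q - ?p) * (2 * sqrt a * sqrt v)) * sqrt u \<le> sqrt u * sqrt u" by (simp add: mult_ac)
    then have "(?q - ?p) * (2 * sqrt a * sqrt v) \<le> sqrt u"
      by (rule mult_right_le_imp_le) (use u in simp)
    then have "?q - ?p \<le> sqrt u / (2 * sqrt a * sqrt v)" using abc that by (simp add: pos_le_divide_eq)
    then show ?thesis using qp unfolding eta_def by simp
  qed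
  define K where "K = sqrt b * sqrt c * sqrt f / (sqrt 2 * sqrt a * sqrt d * sqrt e)"
  \<comment> \<open>\<open>r\<close> is the row of the first-column entry and \<open>u\<close>,
    \<open>v\<close> are the other two; \<open>d * e\<close> is the smallest product of two
    rows.\<close>
  have minor: "\<bar>x r * (eta b u * eta c v - eta c u * eta b v)\<bar> \<le> K"
    if "1 \<le> u" "1 \<le> v" "1 \<le> r" "r \<le> f" "d * e \<le> u * v" for r u v
  proof -
    have "\<bar>x r\<bar> \<le> sqrt 2 * sqrt a * sqrt f"
    proof -
      have "1 * 1 \<le> a * f" using abc w by (intro mult_mono) auto
      moreover have "a * r \<le> a * f" using abc that by (intro mult_left_mono) auto
      ultimately have "a * r + 1 \<le> 2 * a * f" by simp
      then have "sqrt (a * r + 1) \<le> sqrt (2 * a * f)" by (rule real_sqrt_le_mono)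
      moreover have "0 \<le> a * r" using abc that by simp
      ultimately show ?thesis unfolding x_def by (simp add: real_sqrt_mult)
    qed
    moreover have "\<bar>eta b u * eta c v - eta c u * eta b v\<bar> \<le> sqrt b * sqrt c / (2 * a * (sqrt d * sqrt e))"
    proof -
      have t: "\<bar>eta r u * eta s v\<bar> \<le> sqrt r * sqrt s / (2 * a * (sqrt u * sqrt v)) / 2"
        if "a < r" "a < s" for r s
      proof -
        have "\<bar>eta r u * eta s v\<bar> \<le> sqrt r / (2 * sqrt a * sqrt u) * (sqrt s / (2 * sqrt a * sqrt v))"
          unfolding abs_mult using eta abc that \<open>1 \<le> u\<close> \<open>1 \<le> v\<close> by (intro mult_mono) auto
        also have "\<dots> = sqrt r * sqrt s / (2 * a * (sqrt u * sqrt v)) / 2"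
          using abc by (simp add: mult_ac)
        finally show ?thesis .
      qed
      have "a < b" "a < c" using abc by auto
      then have "\<bar>eta b u * eta c v - eta c u * eta b v\<bar>
          \<le> sqrt b * sqrt c / (2 * a * (sqrt u * sqrt v)) / 2 + sqrt c * sqrt b / (2 * a * (sqrt u * sqrt v)) / 2"
        by (intro order_trans[OF abs_triangle_ineq4] add_mono t)
      also have "\<dots> = sqrt b * sqrt c / (2 * a * (sqrt u * sqrt v))"
        by (simp only: mult.commute[of "sqrt c"] field_sum_of_halves)
      also have "\<dots> \<le> sqrt b * sqrt c / (2 * a * (sqrt d * sqrt e))"
      proof -
        have "sqrt d * sqrt e \<le> sqrt u * sqrt v" using that(5) by (simp flip: real_sqrt_mult)
        then show ?thesis using abc w that by (intro divide_left_mono mult_left_mono mult_pos_pos) auto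
      qed
      finally show ?thesis .
    qed
    ultimately have "\<bar>x r * (eta b u * eta c v - eta c u * eta b v)\<bar>
        \<le> (sqrt 2 * sqrt a * sqrt f) * (sqrt b * sqrt c / (2 * a * (sqrt d * sqrt e)))"
      unfolding abs_mult using abc w by (intro mult_mono) auto
    also have "\<dots> = K"
    proof -
      have aa: "a = sqrt a * sqrt a" and tt: "2 = sqrt 2 * sqrt (2::real)" using abc by simp_all
      have "(sqrt 2 * sqrt a * sqrt f) * (sqrt b * sqrt c / ((sqrt 2 * sqrt 2) * (sqrt a * sqrt a) * (sqrt d * sqrt e))) = K"
        unfolding K_def using abc w by (simp add: field_simps del: real_sqrt_mult_self)
      then show ?thesis using aa tt by simp
    qed
    finally show ?thesis .
  qed
  let ?D = "det3 (sqrt_vector a b c d) (sqrt_vector a b c e) (sqrt_vector a b c f)"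
  have de: "d * e \<le> e * f" "d * e \<le> d * f" using w by (auto simp: mult.commute intro!: mult_mono mult_left_mono)
  \<comment> \<open>Writing \<open>a\<close> as \<open>sqrt a * sqrt a\<close> scales the second and
    third columns by \<open>sqrt a\<close> each, which makes their reduced entries equal to
    \<open>eta\<close>.\<close>
  have aD: "a * ?D = x d * (eta b e * eta c f - eta c e * eta b f) - x e * (eta b d * eta c f - eta c d * eta b f)
      + x f * (eta b d * eta c e - eta c d * eta b e)"
  proof -
    have "sqrt a * sqrt a * (x1 * (y2 * z3 - z2 * y3) - x2 * (y1 * z3 - z1 * y3) + x3 * (y1 * z2 - z1 * y2))
      = x1 * ((sqrt a * y2 - t * x2) * (sqrt a * z3 - r * x3) - (sqrt a * z2 - r * x2) * (sqrt a * y3 - t * x3))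
      - x2 * ((sqrt a * y1 - t * x1) * (sqrt a * z3 - r * x3) - (sqrt a * z1 - r * x1) * (sqrt a * y3 - t * x3))
      + x3 * ((sqrt a * y1 - t * x1) * (sqrt a * z2 - r * x2) - (sqrt a * z1 - r * x1) * (sqrt a * y2 - t * x2))"
      for x1 x2 x3 y1 y2 y3 z1 z2 z3 r t :: real
      by (simp add: algebra_simps del: real_sqrt_mult_self)
    moreover have "sqrt a * sqrt a = a" using abc by simp
    ultimately show ?thesis unfolding det3_def sqrt_vector_def eta_def x_def by simp
  qed
  have "\<bar>a * ?D\<bar> \<le> K + K + K"
    unfolding aD using minor[of e f d] minor[of d f e] minor[of d e f] de w by linarith
  then have "\<bar>a * ?D\<bar> ^ 2 \<le> (3 * K) ^ 2" by (intro power_mono) auto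
  also have "(3 * K) ^ 2 = 9 * (b * c * f / (2 * a * d * e))"
    unfolding K_def using abc w by (simp add: power_mult_distrib power_divide)
  finally have "a ^ 2 * ?D ^ 2 \<le> 9 * (b * c * f) / (2 * a * d * e)"
    by (simp add: power_mult_distrib)
  then have "a ^ 2 * ?D ^ 2 * (2 * a * d * e) \<le> 9 * (b * c * f)"
    using abc w by (simp add: pos_le_divide_eq)
  then show ?thesis by (simp add: power3_eq_cube power2_eq_square mult_ac)
qed

text \<open>The determinant is a nonzero integer, so its square in
  \<open>det3_sqrt_vector_le\<close> is at least 1.\<close>

lemma square_gap:
  fixes a b c d e f :: int
  assumes abc: "0 < a" "a < b" "b < c" and w: "0 < d" "d < e" "e < f"
    and sq: "\<And>u v. u \<in> {a, b, c} \<Longrightarrow> v \<in> {d, e, f} \<Longrightarrow> sqrt (of_int (u * v + 1)) \<in> \<int>"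
  shows "2 * a ^ 3 * d * e \<le> 9 * b * c * f"
proof -
  let ?D = "det3 (sqrt_vector (of_int a) (of_int b) (of_int c) (of_int d))
    (sqrt_vector (of_int a) (of_int b) (of_int c) (of_int e)) (sqrt_vector (of_int a) (of_int b) (of_int c) (of_int f))"
  have I: "sqrt (of_int u * of_int v + 1) \<in> \<int>" if "u \<in> {a, b, c}" "v \<in> {d, e, f}" for u v
    using sq[OF that] by simp
  have "?D \<in> \<int>" unfolding det3_def sqrt_vector_def by (auto intro!: Ints_add Ints_diff Ints_mult I)
  moreover have "?D \<noteq> 0" using abc w by (intro det3_sqrt_vector_nonzero) auto
  ultimately have "1 \<le> \<bar>?D\<bar>" by (metis Ints_nonzero_abs_ge1)
  then have "1 \<le> ?D ^ 2" by (simp add: abs_le_square_iff[of 1, simplified])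
  then have "real_of_int (2 * a ^ 3 * d * e) * 1 \<le> of_int (2 * a ^ 3 * d * e) * ?D ^ 2"
    using abc w by (intro mult_left_mono) auto
  also have "\<dots> \<le> of_int (9 * b * c * f)"
    using det3_sqrt_vector_le[of "of_int a" "of_int b" "of_int c" "of_int d" "of_int e" "of_int f"] abc w by simp
  finally show ?thesis by (simp only: mult_1_right of_int_le_iff)
qed

text \<open>Each step is a growth by the power 3/2; the exponents \<open>3 ^ n\<close> and
  \<open>2 ^ n\<close> keep the statement free of roots.\<close>

lemma iterated_growth:
  fixes s :: "nat \<Rightarrow> int"
  assumes "\<And>r. r < n \<Longrightarrow> s r ^ 3 \<le> s (Suc r) ^ 2" "\<And>r. r \<le> n \<Longrightarrow> 0 \<le> s r"
  shows "s 0 ^ (3 ^ n) \<le> s n ^ (2 ^ n)"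
  using assms
proof (induction n)
  case (Suc n)
  have "s 0 ^ (3 ^ Suc n) = (s 0 ^ (3 ^ n)) ^ 3" by (simp add: mult.commute flip: power_mult)
  also have "\<dots> \<le> (s n ^ (2 ^ n)) ^ 3" using Suc by (intro power_mono Suc.IH) auto
  also have "\<dots> = (s n ^ 3) ^ (2 ^ n)" by (simp add: mult.commute flip: power_mult)
  also have "\<dots> \<le> (s (Suc n) ^ 2) ^ (2 ^ n)" using Suc.prems by (intro power_mono) auto
  also have "\<dots> = s (Suc n) ^ (2 ^ Suc n)" by (simp flip: power_mult)
  finally show ?case by simp
qed simp


section \<open>Bipartite families of squares\<close>

definition square_grid :: "nat \<Rightarrow> (nat \<Rightarrow> int) \<Rightarrow> (nat \<Rightarrow> int) \<Rightarrow> bool" where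
  "square_grid t u w \<longleftrightarrow> (\<forall>i<t. 0 < u i \<and> 0 < w i) \<and> strict_mono_on {..<t} u \<and> strict_mono_on {..<t} w
     \<and> (\<forall>i<t. \<forall>j<t. sqrt (of_int (u i * w j + 1)) \<in> \<int>)"

lemma square_grid_sym: "square_grid t u w \<Longrightarrow> square_grid t w u"
  unfolding square_grid_def by (auto simp: mult.commute)

lemma square_grid_less:
  assumes "square_grid t u w" "i < j" "j < t"
  shows "u i < u j"
  using assms strict_mono_onD[of "{..<t}" u i j] unfolding square_grid_def by auto

lemma square_grid_ge:
  assumes "square_grid t u w" "i < t"
  shows "int (Suc i) \<le> u i"
  using assms(2)
proof (induction i)
  case 0
  then show ?case using assms(1) unfolding square_grid_def by fastforce
next
  case (Suc i)
  then have "u i < u (Suc i)" using square_grid_less[OF assms(1)] by simp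
  then show ?case using Suc by simp
qed

lemma square_grid_gap:
  assumes "square_grid t u w" "i < j" "j < k" "k < t" "l < m" "m < n" "n < t"
  shows "2 * u i ^ 3 * w l * w m \<le> 9 * u j * u k * w n"
proof (rule square_gap)
  note sym = square_grid_sym[OF assms(1)]
  show "u i < u j" "u j < u k" "w l < w m" "w m < w n"
    using assms by (auto intro: square_grid_less[OF assms(1)] square_grid_less[OF sym])
  show "0 < u i" "0 < w l" using assms unfolding square_grid_def by auto
  show "sqrt (of_int (v * x + 1)) \<in> \<int>" if "v \<in> {u i, u j, u k}" "x \<in> {w l, w m, w n}" for v x
    using that assms unfolding square_grid_def by auto
qed

text \<open>Beyond \<open>u 2 ^ 400\<close> the gap principle for \<open>u 0\<close>,
  \<open>u 1\<close>, \<open>u 2\<close> forces growth by the power 3/2 every two indices, which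
  soon violates \<open>extension_upper_bound\<close>.\<close>

lemma square_grid_less_power:
  assumes g: "square_grid t u w" and i: "i + 20 < t"
  shows "w i < u 2 ^ 400"
proof (rule ccontr)
  assume "\<not> w i < u 2 ^ 400"
  then have large: "u 2 ^ 400 \<le> w i" by simp
  have mono: "w j < w k" if "j < k" "k < t" for j k
    using square_grid_less[OF square_grid_sym[OF g] that] .
  have u: "0 < u 0" "u 0 < u 1" "u 1 < u 2"
    using square_grid_ge[OF g, of 0] square_grid_less[OF g] i by auto
  have wpos: "0 < w j" if "j < t" for j using g that unfolding square_grid_def by simp
  have sq: "sqrt (of_int (v * w j + 1)) \<in> \<int>" if "v \<in> {u 0, u 1, u 2}" "j < t" for v j
    using g i that unfolding square_grid_def by auto
  \<comment> \<open>The gap principle gives \<open>w j ^ 2 \<le> u 2 ^ 4 * w (j + 2)\<close>. After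
    squaring, one factor \<open>w j\<close> absorbs \<open>u 2 ^ 8\<close>, which lowers the growth
    exponent from 2 to 3/2.\<close>
  have step: "w j ^ 3 \<le> w (j + 2) ^ 2" if "i \<le> j" "j + 2 < t" for j
  proof -
    have wj: "0 < w j" "w j < w (Suc j)" "0 < w (j + 2)" using mono wpos that by auto
    have u3: "3 \<le> u 2" using square_grid_ge[OF g, of 2] i by simp
    have "2 * u 0 ^ 3 * w j * w (Suc j) \<le> 9 * u 1 * u 2 * w (j + 2)"
      using that i by (intro square_grid_gap[OF g]) auto
    also have "\<dots> \<le> u 2 ^ 2 * u 2 * u 2 * w (j + 2)"
      using u u3 wj power_mono[OF u3, of 2] by (intro mult_mono) auto
    also have "\<dots> = u 2 ^ 4 * w (j + 2)" by (simp add: power_numeral_reduce)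
    finally have 1: "2 * u 0 ^ 3 * w j * w (Suc j) \<le> u 2 ^ 4 * w (j + 2)" by simp
    have "1 \<le> u 0 ^ 3" using u by (simp add: one_le_power)
    then have u0: "1 \<le> 2 * u 0 ^ 3" by linarith
    have "1 * w j * w j \<le> 2 * u 0 ^ 3 * w j * w (Suc j)"
      by (intro mult_mono u0) (use u wj in auto)
    with 1 have "w j ^ 2 \<le> u 2 ^ 4 * w (j + 2)" by (simp add: power2_eq_square)
    then have "(w j ^ 2) ^ 2 \<le> (u 2 ^ 4 * w (j + 2)) ^ 2" by (intro power_mono) auto
    also have "\<dots> = u 2 ^ 8 * w (j + 2) ^ 2" by (simp add: power_mult_distrib)
    also have "\<dots> \<le> w j * w (j + 2) ^ 2"
    proof (rule mult_right_mono)
      have "u 2 ^ 8 \<le> u 2 ^ 400" using u3 by (intro power_increasing) auto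
      also have "\<dots> \<le> w j" using large mono[of i j] that by (cases "i = j") auto
      finally show "u 2 ^ 8 \<le> w j" by simp
    qed simp
    finally have "w j * w j ^ 3 \<le> w j * w (j + 2) ^ 2" by (simp add: power_numeral_reduce)
    then show ?thesis using wj by simp
  qed
  \<comment> \<open>Ten double steps use 20 indices and suffice, as \<open>3 ^ 10 = 59049\<close>
    exceeds \<open>42 * 2 ^ 10 = 43008\<close>.\<close>
  have "w (i + 2 * 0) ^ (3 ^ 10) \<le> w (i + 2 * 10) ^ (2 ^ 10)"
  proof (rule iterated_growth)
    show "w (i + 2 * r) ^ 3 \<le> w (i + 2 * Suc r) ^ 2" if "r < 10" for r
      using step[of "i + 2 * r"] that i by simp
    show "0 \<le> w (i + 2 * r)" if "r \<le> 10" for r using wpos[of "i + 2 * r"] that i by simp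
  qed
  moreover have "w (i + 20) < w i ^ 42"
  proof (rule extension_upper_bound[OF u large])
    show "0 < w (i + 20)" using wpos i by simp
    show "sqrt (of_int (v * w i + 1)) \<in> \<int> \<and> sqrt (of_int (v * w (i + 20) + 1)) \<in> \<int>"
      if "v \<in> {u 0, u 1, u 2}" for v
      using sq[OF that] i by simp
  qed
  then have "w (i + 20) ^ 1024 < (w i ^ 42) ^ 1024"
    using wpos[OF i] by (intro power_strict_mono) auto
  ultimately have "w i ^ 59049 < w i ^ 43008" by (simp flip: power_mult)
  moreover have "1 \<le> w i" using wpos[of i] i by simp
  ultimately show False using power_increasing[of 43008 59049 "w i"] by simp
qed

text \<open>The products \<open>p j\<close> grow by the power 3/2 every two indices, whereas
  \<open>square_grid_less_power\<close> in both directions keeps \<open>p 34\<close> below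
  \<open>p 4 ^ 400\<close>.\<close>

lemma square_grid_size:
  assumes g: "square_grid t u w"
  shows "t < 55"
proof (rule ccontr)
  assume "\<not> t < 55"
  then have t: "55 \<le> t" by simp
  note g' = square_grid_sym[OF g]
  define p where "p = (\<lambda>j. u j * w j)"
  have up: "int (Suc j) \<le> u j" "int (Suc j) \<le> w j" if "j < t" for j
    using square_grid_ge[OF g that] square_grid_ge[OF g' that] .
  \<comment> \<open>Multiplying the gap inequality by its mirror image cancels
    \<open>u (Suc j) * w (Suc j)\<close>. Starting at index 4 ensures \<open>p j \<ge> 25\<close>,
    so that \<open>81 \<le> 4 * p j\<close>.\<close>
  have step: "p j ^ 3 \<le> p (j + 2) ^ 2" if "4 \<le> j" "j + 2 < t" for j
  proof -
    have pos: "5 \<le> u j" "5 \<le> w j" "0 < u (Suc j)" "0 < w (Suc j)" "0 < u (j + 2)" "0 < w (j + 2)"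
      using up[of j] up[of "Suc j"] up[of "j + 2"] that by auto
    have "(2 * u j ^ 3 * w j * w (Suc j)) * (2 * w j ^ 3 * u j * u (Suc j))
      \<le> (9 * u (Suc j) * u (j + 2) * w (j + 2)) * (9 * w (Suc j) * w (j + 2) * u (j + 2))"
      using that pos by (intro mult_mono square_grid_gap[OF g] square_grid_gap[OF g']) auto
    then have "(u (Suc j) * w (Suc j)) * (4 * p j ^ 4) \<le> (u (Suc j) * w (Suc j)) * (81 * p (j + 2) ^ 2)"
      unfolding p_def by (simp add: power_numeral_reduce mult_ac)
    then have 1: "4 * p j ^ 4 \<le> 81 * p (j + 2) ^ 2" using pos by simp
    have "5 * 5 \<le> p j" unfolding p_def using pos by (intro mult_mono) auto
    then have "81 * p j ^ 3 \<le> 4 * p j * p j ^ 3" by (intro mult_right_mono) auto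
    also have "\<dots> = 4 * p j ^ 4" by (simp add: power_numeral_reduce)
    finally show ?thesis using 1 by simp
  qed
  have pos: "1 \<le> p j" if "j < t" for j
    unfolding p_def using mult_mono[of 1 "u j" 1 "w j"] up[OF that] by simp
  \<comment> \<open>Fifteen steps lead from 4 to 34, and \<open>3 ^ 15 = 14348907\<close> exceeds
    \<open>400 * 2 ^ 15 = 13107200\<close>. The bound at index 34 requires
    \<open>34 + 20 < t\<close>, hence 55.\<close>
  have "p (4 + 2 * 0) ^ (3 ^ 15) \<le> p (4 + 2 * 15) ^ (2 ^ 15)"
  proof (rule iterated_growth)
    show "p (4 + 2 * r) ^ 3 \<le> p (4 + 2 * Suc r) ^ 2" if "r < 15" for r
      using step[of "4 + 2 * r"] that t by (simp add: algebra_simps)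
    show "0 \<le> p (4 + 2 * r)" if "r \<le> 15" for r using pos[of "4 + 2 * r"] that t by simp
  qed
  moreover have "p 34 < p 4 ^ 400"
  proof -
    have "u 34 * w 34 < w 2 ^ 400 * u 2 ^ 400"
      using square_grid_less_power[OF g, of 34] square_grid_less_power[OF g', of 34] t up[of 34]
      by (intro mult_strict_mono) auto
    also have "\<dots> \<le> w 4 ^ 400 * u 4 ^ 400"
    proof -
      have "w 2 \<le> w 4" "u 2 \<le> u 4"
        using t square_grid_less[OF g, of 2 4] square_grid_less[OF g', of 2 4] by auto
      then show ?thesis using up[of 2] up[of 4] t by (intro mult_mono power_mono) auto
    qed
    finally show ?thesis by (simp add: p_def power_mult_distrib mult_ac)
  qed
  then have "p 34 ^ 32768 < (p 4 ^ 400) ^ 32768"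
    using pos[of 34] t by (intro power_strict_mono) auto
  ultimately have "p 4 ^ 14348907 < p 4 ^ 13107200" by (simp flip: power_mult)
  then show False using power_increasing[of 13107200 14348907 "p 4"] pos[of 4] t by simp
qed

section \<open>From vertex classes to increasing enumerations\<close>

lemma sorted_list_of_set_strict_mono:
  fixes U :: "'a::linorder set"
  shows "strict_mono_on {..<card U} ((!) (sorted_list_of_set U))"
  by (auto intro!: strict_mono_onI sorted_wrt_nth_less[OF strict_sorted_list_of_set])

lemma complete_bipartite_squares_card:
  fixes U W :: "int set"
  assumes fin: "finite U" "finite W" and card: "card U = t" "card W = t"
    and pos: "\<And>v. v \<in> U \<union> W \<Longrightarrow> 0 < v"
    and sq: "\<And>x y. x \<in> U \<Longrightarrow> y \<in> W \<Longrightarrow> is_nth_power 2 (x * y + 1)"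
  shows "t < 55"
proof (rule square_grid_size)
  let ?u = "(!) (sorted_list_of_set U)" and ?w = "(!) (sorted_list_of_set W)"
  have mem: "?u i \<in> U" "?w i \<in> W" if "i < t" for i
    using that fin card nth_mem[of i "sorted_list_of_set U"] nth_mem[of i "sorted_list_of_set W"] by auto
  have "sqrt (of_int (x * y + 1)) \<in> \<int>" if xy: "x \<in> U" "y \<in> W" for x y
  proof -
    obtain z where "x * y + 1 = z ^ 2" using sq[OF xy] by (auto elim: is_nth_powerE)
    then have "sqrt (of_int (x * y + 1)) = of_int \<bar>z\<bar>" by simp
    then show ?thesis by (metis Ints_of_int)
  qed
  then show "square_grid t ?u ?w"
    using mem pos sorted_list_of_set_strict_mono[of U] sorted_list_of_set_strict_mono[of W] card
    unfolding square_grid_def by auto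
qed

theorem theorem4:
  assumes szpiro: "szpiro_conjecture"
    and neron: "neron_conjecture"
  shows "\<exists>C :: nat \<Rightarrow> nat. \<forall>(V :: int set) (t :: nat) (U :: int set) (a :: int) (b :: int).
    finite V \<and> (\<forall>v\<in>V. v > 0) \<and> t \<ge> 1 \<and>
    K\<^bsub>t,t\<^esub> (with_proj (diophantine_graph V)) \<and>
    vertex_class (with_proj (diophantine_graph V)) U \<and> a \<in> U \<and> b \<in> U \<and> a \<noteq> b
    \<longrightarrow> t < C (omega (a * b * (a - b)))"
\<comment> \<open>The bound for grids is uniform, so a constant function is the witness.\<close>
proof (intro exI[of _ "\<lambda>_. 55"] allI impI, elim conjE)
  fix V :: "int set" and t :: nat and U :: "int set" and a b :: int
  assume pos: "\<forall>v\<in>V. v > 0" and K: "K\<^bsub>t,t\<^esub> (with_proj (diophantine_graph V))"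
  obtain A B where parts: "finite V" "V = A \<union> B" "card A = t" "card B = t"
    "parcs (diophantine_graph V) = A \<times> B \<union> B \<times> A"
    using K unfolding complete_bipartite_digraph_pair_def by (auto simp: diophantine_graph_def)
  show "t < 55"
  proof (rule complete_bipartite_squares_card)
    show "is_square (x * y + 1)" if "x \<in> A" "y \<in> B" for x y
    proof -
      have "(x, y) \<in> parcs (diophantine_graph V)" using parts(5) that by blast
      then show ?thesis by (simp add: diophantine_graph_def)
    qed
  qed (use parts pos in auto)
qed

end
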